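(* Consider the $K$-armed stochastic bandit problem with $[0,1]$-supported reward distributions, unique optimal arm $1$ and gaps $\Delta_i=\mu_1-\mu_i$. For every horizon $T$, the pseudo-regret $\mathcal{R}(T)$ of Vanilla Thompson Sampling with Gaussian priors satisfies the problem-dependent bound $$\mathcal{R}(T)\le \sum_{i:\Delta_i>0}\left(\frac{1270\,\ln\left(T\Delta_i^2+100^{1/3}\right)}{\Delta_i}+\frac{182.5}{\Delta_i}+\Delta_i\right).$$ Moreover, its worst-case regret is $O\left(\sqrt{KT\ln K}\right)$, where $O(\cdot)$ hides only a universal constant; that is, there is a universal constant $C>0$ such that $\mathcal{R}(T)\le C\sqrt{KT\ln K}$ for every such bandit instance and every $T$.
   Context: Bandit problem: there is a set of arms $\mathcal{A}=\{1,\dots,K\}$, $K\ge 2$; arm $i$ has an unknown reward distribution $p_i$ supported in $[0,1]$ with mean $\mu_i$. In each round $t=1,2,\dots$, a reward vector $(X_1(t),\dots,X_K(t))$ with $X_i(t)\sim p_i$ is generated, independently across rounds; the learner pulls an arm $i_t$ based on past observations (and its own randomization) and observes only $X_{i_t}(t)$. Arm $1$ is the unique optimal arm: $\mu_1>\mu_i$ for all $i\ne1$; $\Delta_i:=\mu_1-\mu_i$. The pseudo-regret over $T$ rounds is $\mathcal{R}(T)=T\mu_1-\mathbb{E}\left[\sum_{t=1}^T X_{i_t}(t)\right]=\sum_i\sum_{t=1}^T\mathbb{E}\left[\mathbf{1}\{i_t=i\}\right]\Delta_i$. Notation: $n_i(t-1)=\sum_{q=1}^{t-1}\mathbf{1}\{i_q=i\}$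 is the number of pulls of arm $i$ by the end of round $t-1$, and $\hat\mu_{i,n_i(t-1)}=\frac{1}{n_i(t-1)}\sum_{q=1}^{t-1}\mathbf{1}\{i_q=i\}X_i(q)$ is its empirical mean. $\mathcal{N}(\mu,\sigma^2)$ is the Gaussian distribution with mean $\mu$ and variance $\sigma^2$. Vanilla Thompson Sampling (Gaussian priors): pull each arm once in rounds $1,\dots,K$. In each round $t\ge K+1$, draw independently for every arm $i\in\mathcal{A}$ a fresh sample $\theta_i(t)\sim\mathcal{N}\left(\hat\mu_{i,n_i(t-1)},\,1/n_i(t-1)\right)$, pull $i_t\in\arg\max_{i\in\mathcal{A}}\theta_i(t)$, observe $X_{i_t}(t)$, and update $n_{i_t}$ and $\hat\mu_{i_t,n_{i_t}}$. *)

theory Defs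
  imports "HOL-Probability.Probability"
begin

definition mean :: "real measure \<Rightarrow> real" where
  "mean q = (\<integral>x. x \<partial>q)"

text \<open>
  An instance with arms \<open>{1..K}\<close>: \<open>p i\<close> is the reward distribution of arm \<open>i\<close>, and \<open>D\<close> is the joint
  law of the reward vector of one round. Only the marginals of \<open>D\<close> are prescribed; rewards of
  different arms within a round need not be independent.
\<close>

definition bandit :: "nat \<Rightarrow> (nat \<Rightarrow> real measure) \<Rightarrow> (nat \<Rightarrow> real) measure \<Rightarrow> bool" where
  "bandit K p D \<longleftrightarrow>
     K \<ge> 2 \<and>
     (\<forall>i\<in>{1..K}. prob_space (p i) \<and> sets (p i) = sets borel \<and> (AE x in p i. x \<in> {0..1})) \<and>
     (\<forall>i\<in>{1..K}. i \<noteq> 1 \<longrightarrow> mean (p i) < mean (p 1)) \<and>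
     prob_space D \<and> sets D = sets (\<Pi>\<^sub>M i\<in>{1..K}. (borel :: real measure)) \<and>
     (\<forall>i\<in>{1..K}. distr D borel (\<lambda>x. x i) = p i)"

definition gap :: "(nat \<Rightarrow> real measure) \<Rightarrow> nat \<Rightarrow> real" where
  "gap p i = mean (p 1) - mean (p i)"

text \<open>
  A run is a function \<open>\<omega>\<close> on rounds; \<open>\<omega> q = (i, x)\<close> means that in round \<open>q\<close> the reward vector \<open>x\<close>
  was generated and arm \<open>i\<close> was pulled. The learner uses \<open>\<omega> q\<close> only through \<open>i\<close> and \<open>x i\<close>.
\<close>

type_synonym run = "nat \<Rightarrow> nat \<times> (nat \<Rightarrow> real)"

definition arm :: "run \<Rightarrow> nat \<Rightarrow> nat" where
  "arm \<omega> q = fst (\<omega> q)"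

definition reward :: "run \<Rightarrow> nat \<Rightarrow> nat \<Rightarrow> real" where
  "reward \<omega> i q = snd (\<omega> q) i"

definition pulls :: "run \<Rightarrow> nat \<Rightarrow> nat \<Rightarrow> nat" where
  "pulls \<omega> i t = (\<Sum>q\<in>{1..t}. of_bool (arm \<omega> q = i))"

definition emp_mean :: "run \<Rightarrow> nat \<Rightarrow> nat \<Rightarrow> real" where
  "emp_mean \<omega> i t = 1 / real (pulls \<omega> i t) * (\<Sum>q\<in>{1..t}. of_bool (arm \<omega> q = i) * reward \<omega> i q)"

text \<open>The second argument is the variance, whereas \<^const>\<open>normal_density\<close> takes the standard deviation.\<close>

definition gaussian :: "real \<Rightarrow> real \<Rightarrow> real measure" where
  "gaussian \<mu> v = density lborel (normal_density \<mu> (sqrt v))"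

definition run_space :: "nat \<Rightarrow> nat \<Rightarrow> run measure" where
  "run_space K t = (\<Pi>\<^sub>M q\<in>{1..t}. count_space UNIV \<Otimes>\<^sub>M (\<Pi>\<^sub>M i\<in>{1..K}. borel))"

text \<open>
  Parameters of the algorithm left open by its description: \<open>init t\<close> is the arm pulled in
  round \<open>t \<le> K\<close>, and \<open>brk S\<close> is the arm selected from the set \<open>S\<close> of maximisers
  (ties in later rounds have probability zero).
\<close>

definition ts_params :: "nat \<Rightarrow> (nat \<Rightarrow> nat) \<Rightarrow> (nat set \<Rightarrow> nat) \<Rightarrow> bool" where
  "ts_params K init brk \<longleftrightarrow>
     bij_betw init {1..K} {1..K} \<and> (\<forall>S. S \<subseteq> {1..K} \<and> S \<noteq> {} \<longrightarrow> brk S \<in> S)"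

definition ts_samples :: "nat \<Rightarrow> nat \<Rightarrow> run \<Rightarrow> (nat \<Rightarrow> real) measure" where
  "ts_samples K t \<omega> =
     (\<Pi>\<^sub>M i\<in>{1..K}. gaussian (emp_mean \<omega> i (t - 1)) (1 / real (pulls \<omega> i (t - 1))))"

definition ts_choice ::
  "nat \<Rightarrow> (nat \<Rightarrow> nat) \<Rightarrow> (nat set \<Rightarrow> nat) \<Rightarrow> nat \<Rightarrow> run \<Rightarrow> nat measure" where
  "ts_choice K init brk t \<omega> =
     (if t \<le> K then return (count_space UNIV) (init t)
      else do {
        \<theta> \<leftarrow> ts_samples K t \<omega>;
        return (count_space UNIV) (brk {i. is_arg_max \<theta> (\<lambda>i. i \<in> {1..K}) i})
      })"

text \<open>The law of the first \<open>t\<close> rounds of Vanilla Thompson Sampling.\<close>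

primrec ts_run ::
  "nat \<Rightarrow> (nat \<Rightarrow> real) measure \<Rightarrow> (nat \<Rightarrow> nat) \<Rightarrow> (nat set \<Rightarrow> nat) \<Rightarrow> nat \<Rightarrow> run measure" where
  "ts_run K D init brk 0 = return (run_space K 0) (\<lambda>_. undefined)"
| "ts_run K D init brk (Suc t) = do {
     \<omega> \<leftarrow> ts_run K D init brk t;
     x \<leftarrow> D;
     i \<leftarrow> ts_choice K init brk (Suc t) \<omega>;
     return (run_space K (Suc t)) (fun_upd \<omega> (Suc t) (i, x))
   }"

definition ts_regret ::
  "nat \<Rightarrow> (nat \<Rightarrow> real measure) \<Rightarrow> (nat \<Rightarrow> real) measure \<Rightarrow> (nat \<Rightarrow> nat) \<Rightarrow> (nat set \<Rightarrow> nat) \<Rightarrow> nat \<Rightarrow> real"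
  where
  "ts_regret K p D init brk T =
     real T * mean (p 1)
       - (\<integral>\<omega>. (\<Sum>t\<in>{1..T}. reward \<omega> (arm \<omega> t) t) \<partial>(ts_run K D init brk T))"

end

theory Submission
  imports Defs
begin

text \<open>
  Fix a suboptimal arm \<open>i\<close> with gap \<open>\<Delta>\<close> and put \<open>y = \<mu>\<^sub>1 - \<Delta>/3\<close>. Once \<open>i\<close> has been pulled
  \<open>18 ln (T\<Delta>\<^sup>2 + 100 powr (1/3)) / \<Delta>\<^sup>2\<close> times, a pull of \<open>i\<close> requires that its empirical mean exceeds
  \<open>\<mu>\<^sub>i + \<Delta>/3\<close>, or that its sample exceeds \<open>y\<close> although its empirical mean does not exceed
  \<open>\<mu>\<^sub>i + \<Delta>/3\<close>, or that all samples are at most \<open>y\<close>. The last event has at most the conditional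
  probability of pulling arm 1, times the odds \<open>(1 - P) / P\<close>, where \<open>P\<close> is the probability that the
  sample of arm 1 exceeds \<open>y\<close>. After \<open>s\<close> pulls of arm 1 with total reward \<open>S\<close> these odds are at most
  \<open>3 exp (3/2 (S - s\<mu>\<^sub>1)\<^sup>2 / s - s\<Delta>\<^sup>2/36)\<close>, whose expectation is at most \<open>6 exp (- s\<Delta>\<^sup>2/36)\<close> by Hoeffding's
  lemma, so summing over \<open>s\<close> costs only a constant multiple of \<open>1/\<Delta>\<^sup>2\<close>. For the worst case, arms
  with gap at most \<open>sqrt (K ln K / T)\<close> are charged that gap per pull.
\<close>

section \<open>Gaussian measures\<close>

text \<open>The obstacle is the odds factor: when the rewards of arm 1 start badly, it is
  exponentially large in the squared deviation of its empirical mean, so only its average can be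
  controlled. That average is finite because the samples are more dispersed than the noise. With
  sampling variance \<open>1/s\<close>, the crude tail bound used here lets the odds grow like
  \<open>exp (c * (S - s * \<mu> 1)^2 / s)\<close> with \<open>c = 1\<close>, while rewards in an
  interval of length 1 have variance proxy \<open>1/4\<close>, so that Hoeffding's lemma keeps this
  moment finite for all \<open>c < 2\<close>. The choice \<open>c = 3/2\<close> lies in between and
  makes the moment bound exactly 2. The second difficulty is that the round of the s-th pull of an
  arm is random and may never come. Estimates for fixed \<open>s\<close> are therefore stated as
  charges paid at the pull that finds \<open>s\<close> earlier ones, and are proved by a one-step
  recursion over rounds instead of along a prescribed reward sequence of the arm.\<close>

lemma sets_gaussian [simp, measurable_cong]: "sets (gaussian m v) = sets borel"
  by (simp add: gaussian_def)

lemma space_gaussian [simp]: "space (gaussian m v) = UNIV"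
  by (simp add: gaussian_def)

lemma emeasure_gaussian:
  "A \<in> sets borel \<Longrightarrow>
     emeasure (gaussian m v) A = (\<integral>\<^sup>+x. ennreal (normal_density m (sqrt v) x) * indicator A x \<partial>lborel)"
  by (simp add: gaussian_def emeasure_density)

lemma prob_space_gaussian: "v > 0 \<Longrightarrow> prob_space (gaussian m v)"
  by (simp add: gaussian_def prob_space_normal_density)

text \<open>With division by zero equal to 0, the density vanishes identically, so the degenerate
  Gaussian is the zero measure and not a point mass. The case does occur: an arm without pulls has
  variance \<open>1 / 0 = 0\<close> in \<open>ts_samples\<close>.\<close>

lemma gaussian_zero_variance: "gaussian m 0 = null_measure borel"
  by (rule measure_eqI) (simp_all add: emeasure_gaussian normal_density_def)

lemma subprob_space_gaussian: "v \<ge> 0 \<Longrightarrow> subprob_space (gaussian m v)"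
  by (cases "v = 0")
     (auto simp: gaussian_zero_variance intro!: subprob_spaceI prob_space_imp_subprob_space[OF prob_space_gaussian])

lemma nn_integral_normal_density: "s > 0 \<Longrightarrow> (\<integral>\<^sup>+x. ennreal (normal_density m s x) \<partial>lborel) = 1"
  by (simp add: nn_integral_eq_integral)

text \<open>Recentring: by the last hypothesis the density on \<open>A\<close> is at most the stated
  constant times the density of the Gaussian centred at \<open>y\<close>, whose total mass is 1.
  Both tail bounds below are instances.\<close>

lemma gaussian_le_shift:
  assumes "v > 0" "A \<in> sets borel" "\<And>x. x \<in> A \<Longrightarrow> (x - y)\<^sup>2 + (y - m)\<^sup>2 \<le> (x - m)\<^sup>2"
  shows "emeasure (gaussian m v) A \<le> ennreal (exp (- (y - m)\<^sup>2 / (2 * v)))"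
proof -
  have "normal_density m (sqrt v) x \<le> exp (- (y - m)\<^sup>2 / (2 * v)) * normal_density y (sqrt v) x"
    if "x \<in> A" for x
  proof -
    have "- (x - m)\<^sup>2 / (2 * v) \<le> - (y - m)\<^sup>2 / (2 * v) + - (x - y)\<^sup>2 / (2 * v)"
      using assms(3)[OF that] \<open>v > 0\<close> by (simp add: field_simps)
    then have "exp (- (x - m)\<^sup>2 / (2 * v)) \<le> exp (- (y - m)\<^sup>2 / (2 * v)) * exp (- (x - y)\<^sup>2 / (2 * v))"
      by (simp flip: exp_add)
    then show ?thesis
      using \<open>v > 0\<close> by (simp add: normal_density_def divide_right_mono)
  qed
  then have "emeasure (gaussian m v) A \<le>
      (\<integral>\<^sup>+x. ennreal (exp (- (y - m)\<^sup>2 / (2 * v))) * ennreal (normal_density y (sqrt v) x) \<partial>lborel)"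
    unfolding emeasure_gaussian[OF assms(2)]
    by (intro nn_integral_mono) (auto simp: indicator_def ennreal_leI simp flip: ennreal_mult)
  also have "\<dots> = ennreal (exp (- (y - m)\<^sup>2 / (2 * v)))"
    using \<open>v > 0\<close> by (simp add: nn_integral_cmult nn_integral_normal_density)
  finally show ?thesis .
qed

lemma gaussian_upper_tail:
  assumes "v > 0" "m \<le> y"
  shows "emeasure (gaussian m v) {y<..} \<le> ennreal (exp (- (y - m)\<^sup>2 / (2 * v)))"
proof (rule gaussian_le_shift)
  fix x assume "x \<in> {y<..}"
  then have "0 \<le> (x - y) * (y - m)" using assms by (intro mult_nonneg_nonneg) auto
  then show "(x - y)\<^sup>2 + (y - m)\<^sup>2 \<le> (x - m)\<^sup>2"
    by (simp add: power2_eq_square algebra_simps)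
qed (use assms in auto)

lemma gaussian_lower_tail:
  assumes "v > 0" "y \<le> m"
  shows "emeasure (gaussian m v) {..y} \<le> ennreal (exp (- (y - m)\<^sup>2 / (2 * v)))"
proof (rule gaussian_le_shift)
  fix x assume "x \<in> {..y}"
  then have "0 \<le> (y - x) * (m - y)" using assms by (intro mult_nonneg_nonneg) auto
  then show "(x - y)\<^sup>2 + (y - m)\<^sup>2 \<le> (x - m)\<^sup>2"
    by (simp add: power2_eq_square algebra_simps)
qed (use assms in auto)

text \<open>The reflection \<open>x\<close> to \<open>2 * m - x\<close> exchanges the two
  half-lines, and the point \<open>m\<close> itself is null.\<close>

lemma gaussian_above_mean:
  assumes "v > 0"
  shows "ennreal (1 / 2) \<le> emeasure (gaussian m v) {m<..}"
proof -
  interpret prob_space "gaussian m v" by (rule prob_space_gaussian) fact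
  have "emeasure (gaussian m v) {m<..} =
      (\<integral>\<^sup>+x. ennreal (normal_density m (sqrt v) (2 * m + (-1) * x)) * indicator {m<..} (2 * m + (-1) * x) \<partial>lborel)"
    unfolding emeasure_gaussian[OF greaterThan_borel] by (subst nn_integral_real_affine[of _ "-1" "2 * m"]) auto
  also have "\<dots> = (\<integral>\<^sup>+x. ennreal (normal_density m (sqrt v) x) * indicator {..<m} x \<partial>lborel)"
    by (intro nn_integral_cong) (auto simp: indicator_def normal_density_def power2_eq_square algebra_simps)
  also have "\<dots> = emeasure (gaussian m v) {..<m}"
    by (simp add: emeasure_gaussian)
  finally have sym: "emeasure (gaussian m v) {m<..} = emeasure (gaussian m v) {..<m}" .
  have "emeasure (gaussian m v) {m} = 0"
    by (simp add: emeasure_gaussian nn_integral_0_iff_AE)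
  have "{m<..} \<union> {..<m} \<union> {m} = UNIV" by auto
  then have "1 = emeasure (gaussian m v) ({m<..} \<union> {..<m} \<union> {m})"
    using emeasure_space_1 by simp
  also have "\<dots> \<le> emeasure (gaussian m v) {m<..} + emeasure (gaussian m v) {..<m} + emeasure (gaussian m v) {m}"
    by (intro order_trans[OF emeasure_subadditive] add_mono emeasure_subadditive) auto
  finally have "1 \<le> 2 * emeasure (gaussian m v) {m<..}"
    using sym \<open>emeasure (gaussian m v) {m} = 0\<close> by (simp add: mult_2)
  then have "1 \<le> 2 * measure (gaussian m v) {m<..}"
    by (simp add: emeasure_eq_measure ennreal_mult'[symmetric] flip: ennreal_numeral)
  then show ?thesis
    unfolding emeasure_eq_measure by (intro ennreal_leI) simp
qed

text \<open>From \<open>(a + b)^2 \<le> 2 * a^2 + 2 * b^2\<close>, the density dominates a multiple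
  of the density centred at \<open>y\<close> with variance \<open>v / 2\<close>, half of whose mass
  lies above \<open>y\<close>. The argument covers both orders of \<open>m\<close> and
  \<open>y\<close>; its price is an exponent twice the true tail exponent.\<close>

lemma gaussian_upper_tail_ge:
  assumes "v > 0"
  shows "ennreal (exp (- (y - m)\<^sup>2 / v) / (2 * sqrt 2)) \<le> emeasure (gaussian m v) {y<..}"
proof -
  define c where "c = exp (- (y - m)\<^sup>2 / v) / sqrt 2"
  have "c * normal_density y (sqrt (v / 2)) x \<le> normal_density m (sqrt v) x" for x
  proof -
    have "0 \<le> (x + m - 2 * y)\<^sup>2" by simp
    then have "(x - m)\<^sup>2 \<le> 2 * (x - y)\<^sup>2 + 2 * (y - m)\<^sup>2"
      by (simp add: power2_eq_square algebra_simps)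
    then have "(x - m)\<^sup>2 / (2 * v) \<le> (2 * (x - y)\<^sup>2 + 2 * (y - m)\<^sup>2) / (2 * v)"
      using \<open>v > 0\<close> by (intro divide_right_mono) auto
    then have "- (y - m)\<^sup>2 / v + - (x - y)\<^sup>2 / v \<le> - (x - m)\<^sup>2 / (2 * v)"
      by (simp add: add_divide_distrib)
    then have "exp (- (y - m)\<^sup>2 / v) * exp (- (x - y)\<^sup>2 / v) \<le> exp (- (x - m)\<^sup>2 / (2 * v))"
      by (simp flip: exp_add)
    then show ?thesis
      using \<open>v > 0\<close> unfolding normal_density_def c_def
      by (simp add: real_sqrt_mult real_sqrt_divide divide_simps)
  qed
  then have "(\<integral>\<^sup>+x. ennreal c * (ennreal (normal_density y (sqrt (v / 2)) x) * indicator {y<..} x) \<partial>lborel)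
      \<le> emeasure (gaussian m v) {y<..}"
    by (subst emeasure_gaussian)
       (auto intro!: nn_integral_mono simp: c_def indicator_def ennreal_leI simp flip: ennreal_mult)
  then have "ennreal c * emeasure (gaussian y (v / 2)) {y<..} \<le> emeasure (gaussian m v) {y<..}"
    by (simp add: nn_integral_cmult emeasure_gaussian)
  moreover have "ennreal c * ennreal (1 / 2) \<le> ennreal c * emeasure (gaussian y (v / 2)) {y<..}"
    using gaussian_above_mean[of "v / 2" y] \<open>v > 0\<close> by (intro mult_left_mono) auto
  moreover have "ennreal c * ennreal (1 / 2) = ennreal (exp (- (y - m)\<^sup>2 / v) / (2 * sqrt 2))"
    unfolding c_def by (subst ennreal_mult[symmetric]) (auto simp: mult.commute)
  ultimately show ?thesis
    by simp
qed

text \<open>Here \<open>y + d\<close> plays the true mean and \<open>m\<close> the empirical one. If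
  \<open>m \<le> y\<close>, the left side is at most 1 and \<open>gaussian_upper_tail_ge\<close>
  bounds the right factor from below; since \<open>y - m\<close> and \<open>d\<close> are both
  nonnegative, their squares add up to at most \<open>(y + d - m)^2\<close>. If
  \<open>m > y\<close>, the right factor is at least 1/2 and the left side is a small tail;
  \<open>d\<close> is the sum of \<open>y + d - m\<close> and \<open>m - y\<close>, so the empirical
  mean is either off or far above \<open>y\<close>. The subtracted \<open>d^2 / (4 * v)\<close> is
  the reserve that later makes the sum over the number of pulls converge.\<close>

lemma gaussian_odds_le:
  assumes v: "v > 0" and "d \<ge> 0"
  shows "emeasure (gaussian m v) {..y}
      \<le> ennreal (3 * exp (3 / 2 * (y + d - m)\<^sup>2 / v - d\<^sup>2 / (4 * v))) * emeasure (gaussian m v) {y<..}"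
    (is "_ \<le> ennreal ?c * _")
proof (cases "m \<le> y")
  case True
  interpret prob_space "gaussian m v" by (rule prob_space_gaussian) fact
  have "0 \<le> (y - m) * d" using True \<open>d \<ge> 0\<close> by simp
  then have a: "(y - m)\<^sup>2 + d\<^sup>2 \<le> (y + d - m)\<^sup>2"
    by (simp add: power2_eq_square algebra_simps)
  have "(3/2) * (y + d - m)\<^sup>2 - d\<^sup>2 / 4 - (y - m)\<^sup>2 \<ge> 0"
    using a zero_le_power2[of "y - m"] zero_le_power2[of d] by linarith
  then have "0 \<le> ((3/2) * (y + d - m)\<^sup>2 - d\<^sup>2 / 4 - (y - m)\<^sup>2) / v"
    using v by simp
  then have "0 \<le> 3 / 2 * (y + d - m)\<^sup>2 / v - d\<^sup>2 / (4 * v) + - (y - m)\<^sup>2 / v"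
    by (simp add: diff_divide_distrib)
  then have e: "1 \<le> exp (3 / 2 * (y + d - m)\<^sup>2 / v - d\<^sup>2 / (4 * v) + - (y - m)\<^sup>2 / v)"
    by simp
  \<comment> \<open>The factor 3 of the statement is \<open>2 * sqrt 2\<close> rounded up.\<close>
  have "sqrt 2 \<le> 3 / 2" by (rule real_le_lsqrt) (auto simp: power2_eq_square)
  then have "1 \<le> 3 / (2 * sqrt 2)" by simp
  then have "1 * 1 \<le> 3 / (2 * sqrt 2) * exp (3 / 2 * (y + d - m)\<^sup>2 / v - d\<^sup>2 / (4 * v) + - (y - m)\<^sup>2 / v)"
    using e by (intro mult_mono) auto
  also have "\<dots> = ?c * (exp (- (y - m)\<^sup>2 / v) / (2 * sqrt 2))"
    unfolding exp_add by simp
  finally have "1 \<le> ennreal ?c * ennreal (exp (- (y - m)\<^sup>2 / v) / (2 * sqrt 2))"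
    by (simp flip: ennreal_mult)
  also have "\<dots> \<le> ennreal ?c * emeasure (gaussian m v) {y<..}"
    by (intro mult_left_mono gaussian_upper_tail_ge v) auto
  finally show ?thesis
    using emeasure_le_1[of "{..y}"] by (rule order_trans[rotated])
next
  case False
  have "0 \<le> (y + d - m - (m - y))\<^sup>2" by simp
  then have "d\<^sup>2 \<le> 2 * (y + d - m)\<^sup>2 + 2 * (y - m)\<^sup>2"
    by (simp add: power2_eq_square algebra_simps)
  then have "- (y - m)\<^sup>2 / 2 \<le> 3 / 2 * (y + d - m)\<^sup>2 - d\<^sup>2 / 4"
    using zero_le_power2[of "y + d - m"] by linarith
  then have "- (y - m)\<^sup>2 / 2 / v \<le> (3 / 2 * (y + d - m)\<^sup>2 - d\<^sup>2 / 4) / v"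
    using v by (intro divide_right_mono) auto
  then have "- (y - m)\<^sup>2 / (2 * v) \<le> 3 / 2 * (y + d - m)\<^sup>2 / v - d\<^sup>2 / (4 * v)"
    by (simp add: diff_divide_distrib)
  then have "exp (- (y - m)\<^sup>2 / (2 * v)) \<le> exp (3 / 2 * (y + d - m)\<^sup>2 / v - d\<^sup>2 / (4 * v))"
    by simp
  also have "\<dots> \<le> ?c * (1 / 2)"
    by simp
  finally have "ennreal (exp (- (y - m)\<^sup>2 / (2 * v))) \<le> ennreal (?c * (1 / 2))"
    by (rule ennreal_leI)
  also have "\<dots> = ennreal ?c * ennreal (1 / 2)"
    by (rule ennreal_mult) auto
  also have "\<dots> \<le> ennreal ?c * emeasure (gaussian m v) {m<..}"
    by (intro mult_left_mono gaussian_above_mean v) auto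
  also have "\<dots> \<le> ennreal ?c * emeasure (gaussian m v) {y<..}"
    using False by (intro mult_left_mono emeasure_mono) auto
  finally show ?thesis
    using gaussian_lower_tail[OF v, of y m] False by (simp add: order_trans)
qed

section \<open>Exponential moments of the standard normal distribution\<close>

lemma nn_integral_exp_std_normal:
  "(\<integral>\<^sup>+g. ennreal (exp (b * g)) * ennreal (std_normal_density g) \<partial>lborel) = ennreal (exp (b\<^sup>2 / 2))"
proof -
  have "exp (b * g) * std_normal_density g = exp (b\<^sup>2 / 2) * normal_density b 1 g" for g
    by (simp add: normal_density_def power2_eq_square algebra_simps diff_divide_distrib add_divide_distrib flip: exp_add)
  then show ?thesis
    by (simp add: nn_integral_cmult nn_integral_normal_density ennreal_mult flip: ennreal_mult)
       (simp add: nn_integral_cmult nn_integral_normal_density ennreal_mult)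
qed

text \<open>The exponents combine to \<open>- g^2 / 8\<close>, which is the exponent for standard
  deviation 2; the value 2 is the ratio of the normalising factors.\<close>

lemma nn_integral_exp_square_std_normal:
  "(\<integral>\<^sup>+g. ennreal (exp (3 * g\<^sup>2 / 8)) * ennreal (std_normal_density g) \<partial>lborel) = 2"
proof -
  have "exp (3 * g\<^sup>2 / 8) * std_normal_density g = 2 * normal_density 0 2 g" for g
    using real_sqrt_mult[of 4 2] by (simp add: normal_density_def real_sqrt_mult flip: exp_add)
  then show ?thesis
    by (simp flip: ennreal_mult)
       (simp add: nn_integral_cmult nn_integral_normal_density ennreal_mult)
qed

section \<open>Products of Gaussians as images of one fixed product\<close>

lemma gaussian_eq_distr:
  assumes "v > 0"
  shows "gaussian m v = distr (gaussian 0 1) borel (\<lambda>z. m + sqrt v * z)"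
proof (rule measure_eqI)
  fix A assume "A \<in> sets (gaussian m v)"
  then have A[measurable]: "A \<in> sets borel" by simp
  have "emeasure (gaussian m v) A =
      sqrt v * (\<integral>\<^sup>+z. ennreal (normal_density m (sqrt v) (m + sqrt v * z)) * indicator A (m + sqrt v * z) \<partial>lborel)"
    unfolding emeasure_gaussian[OF A] using \<open>v > 0\<close>
    by (subst nn_integral_real_affine[of _ "sqrt v" m]) auto
  also have "\<dots> = (\<integral>\<^sup>+z. ennreal (sqrt v * normal_density m (sqrt v) (m + sqrt v * z)) * indicator A (m + sqrt v * z) \<partial>lborel)"
    using \<open>v > 0\<close> by (subst nn_integral_cmult[symmetric]) (auto simp: ennreal_mult mult.assoc)
  also have "\<dots> = (\<integral>\<^sup>+z. ennreal (normal_density 0 1 z) * indicator ((\<lambda>z. m + sqrt v * z) -` A) z \<partial>lborel)"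
    using \<open>v > 0\<close>
    by (intro nn_integral_cong) (auto simp: normal_density_def indicator_def real_sqrt_mult power_mult_distrib)
  also have "\<dots> = emeasure (distr (gaussian 0 1) borel (\<lambda>z. m + sqrt v * z)) A"
    using measurable_sets_borel[of "\<lambda>z. m + sqrt v * z" borel A]
    by (simp add: emeasure_distr emeasure_gaussian)
  finally show "emeasure (gaussian m v) A = emeasure (distr (gaussian 0 1) borel (\<lambda>z. m + sqrt v * z)) A" .
qed simp

lemma product_sigma_finite_gaussian:
  assumes "\<And>i. v i \<ge> 0"
  shows "product_sigma_finite (\<lambda>i. gaussian (m i) (v i))"
proof
  fix i
  interpret subprob_space "gaussian (m i) (v i)" by (rule subprob_space_gaussian) (rule assms)
  show "\<exists>A. countable A \<and> A \<subseteq> sets (gaussian (m i) (v i)) \<and> \<Union> A = space (gaussian (m i) (v i)) \<and>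
      (\<forall>a\<in>A. emeasure (gaussian (m i) (v i)) a \<noteq> \<infinity>)"
    by (rule sigma_finite_countable)
qed

text \<open>Makes the parameters \<open>m\<close> and \<open>v\<close> enter only through a map
  applied to one fixed measure. Measurable dependence of the sampling law on the history then
  reduces to joint measurability of that map.\<close>

lemma PiM_gaussian_eq_distr:
  assumes I: "finite I" and v: "\<And>i. v i \<ge> 0" "\<And>i. i \<in> I \<Longrightarrow> v i > 0"
  shows "(\<Pi>\<^sub>M i\<in>I. gaussian (m i) (v i)) =
    distr (\<Pi>\<^sub>M i\<in>I. gaussian 0 1) (\<Pi>\<^sub>M i\<in>I. borel) (\<lambda>z. \<lambda>i\<in>I. m i + sqrt (v i) * z i)"
    (is "_ = distr ?N ?B ?f")
proof -
  interpret product_sigma_finite "\<lambda>i. gaussian (m i) (v i)"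
    by (rule product_sigma_finite_gaussian) (rule v)
  interpret N: product_sigma_finite "\<lambda>_. gaussian 0 1"
    by (rule product_sigma_finite_gaussian) simp
  have f[measurable]: "?f \<in> measurable ?N ?B"
    by measurable
  have "distr ?N ?B ?f = (\<Pi>\<^sub>M i\<in>I. gaussian (m i) (v i))"
  proof (rule PiM_eqI[OF I])
    show "sets (distr ?N ?B ?f) = sets (\<Pi>\<^sub>M i\<in>I. gaussian (m i) (v i))"
      by (simp cong: sets_PiM_cong)
    fix A assume "\<And>i. i \<in> I \<Longrightarrow> A i \<in> sets (gaussian (m i) (v i))"
    then have A: "A i \<in> sets borel" if "i \<in> I" for i
      using that by simp
    have pre: "(\<lambda>z. m i + sqrt (v i) * z) -` A i \<in> sets borel" if "i \<in> I" for i
      by (rule measurable_sets_borel[OF _ A[OF that]]) simp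
    have "emeasure (distr ?N ?B ?f) (Pi\<^sub>E I A) = emeasure ?N (?f -` Pi\<^sub>E I A \<inter> space ?N)"
      using A I by (intro emeasure_distr) (auto intro!: sets_PiM_I_finite)
    also have "?f -` Pi\<^sub>E I A \<inter> space ?N = (\<Pi>\<^sub>E i\<in>I. (\<lambda>z. m i + sqrt (v i) * z) -` A i)"
      by (auto simp: space_PiM PiE_iff)
    also have "emeasure ?N \<dots> = (\<Prod>i\<in>I. emeasure (gaussian 0 1) ((\<lambda>z. m i + sqrt (v i) * z) -` A i))"
      using pre by (intro N.emeasure_PiM[OF I]) simp
    also have "\<dots> = (\<Prod>i\<in>I. emeasure (gaussian (m i) (v i)) (A i))"
      using A by (intro prod.cong refl) (simp add: gaussian_eq_distr[OF v(2)] emeasure_distr)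
    finally show "emeasure (distr ?N ?B ?f) (Pi\<^sub>E I A) = \<dots>" .
  qed
  then show ?thesis ..
qed

text \<open>A single zero factor annihilates every box. Together with
  \<open>PiM_gaussian_eq_distr\<close> this covers all histories, including those in which some arm
  has not been pulled.\<close>

lemma PiM_gaussian_eq_null_measure:
  assumes I: "finite I" and v: "\<And>i. v i \<ge> 0" and i: "i \<in> I" "v i = 0"
  shows "(\<Pi>\<^sub>M i\<in>I. gaussian (m i) (v i)) = null_measure (\<Pi>\<^sub>M i\<in>I. borel)"
proof -
  interpret product_sigma_finite "\<lambda>i. gaussian (m i) (v i)"
    by (rule product_sigma_finite_gaussian) (rule v)
  have "null_measure (\<Pi>\<^sub>M i\<in>I. borel) = (\<Pi>\<^sub>M i\<in>I. gaussian (m i) (v i))"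
  proof (rule PiM_eqI[OF I])
    show "sets (null_measure (\<Pi>\<^sub>M i\<in>I. borel)) = sets (\<Pi>\<^sub>M i\<in>I. gaussian (m i) (v i))"
      by (simp cong: sets_PiM_cong)
    fix A
    show "emeasure (null_measure (\<Pi>\<^sub>M i\<in>I. borel)) (Pi\<^sub>E I A) = (\<Prod>i\<in>I. emeasure (gaussian (m i) (v i)) (A i))"
      using i I by (auto simp: gaussian_zero_variance prod_zero_iff intro!: bexI[of _ i])
  qed
  then show ?thesis ..
qed

section \<open>The law of the run\<close>

lemma measurable_arm:
  assumes "q \<in> {1..t}"
  shows "(\<lambda>\<omega>. arm \<omega> q) \<in> measurable (run_space K t) (count_space UNIV)"
  using assms unfolding arm_def run_space_def by measurable

lemma measurable_reward:
  assumes "q \<in> {1..t}" "i \<in> {1..K}"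
  shows "(\<lambda>\<omega>. reward \<omega> i q) \<in> borel_measurable (run_space K t)"
  using assms unfolding reward_def run_space_def by measurable

lemma measurable_pulls:
  assumes "s \<le> t"
  shows "(\<lambda>\<omega>. pulls \<omega> i s) \<in> measurable (run_space K t) (count_space UNIV)"
proof -
  have [measurable]: "(\<lambda>\<omega>. arm \<omega> q) \<in> measurable (run_space K t) (count_space UNIV)" if "q \<in> {1..s}" for q
    using that assms by (intro measurable_arm) auto
  show ?thesis
    unfolding pulls_def by measurable
qed

definition reward_sum :: "run \<Rightarrow> nat \<Rightarrow> nat \<Rightarrow> real" where
  "reward_sum \<omega> i t = (\<Sum>q\<in>{1..t}. of_bool (arm \<omega> q = i) * reward \<omega> i q)"

lemma emp_mean_eq: "emp_mean \<omega> i t = reward_sum \<omega> i t / real (pulls \<omega> i t)"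
  by (simp add: emp_mean_def reward_sum_def)

lemma measurable_reward_sum:
  assumes "s \<le> t" "i \<in> {1..K}"
  shows "(\<lambda>\<omega>. reward_sum \<omega> i s) \<in> borel_measurable (run_space K t)"
proof -
  have [measurable]: "(\<lambda>\<omega>. arm \<omega> q) \<in> measurable (run_space K t) (count_space UNIV)"
    "(\<lambda>\<omega>. reward \<omega> i q) \<in> borel_measurable (run_space K t)" if "q \<in> {1..s}" for q
    using that assms by (auto intro!: measurable_arm measurable_reward)
  show ?thesis
    unfolding reward_sum_def by measurable
qed

text \<open>Two cases, split by a measurable set of histories: if every arm has been pulled, the
  samples are an affine image of independent standard normals; otherwise their law is the zero
  measure.\<close>

lemma measurable_ts_samples:
  "ts_samples K (Suc t) \<in> measurable (run_space K t) (subprob_algebra (\<Pi>\<^sub>M i\<in>{1..K}. borel))"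
proof -
  let ?B = "\<Pi>\<^sub>M i\<in>{1..K}. (borel :: real measure)"
  let ?N = "\<Pi>\<^sub>M i\<in>{1..K}. gaussian 0 1"
  have [measurable]: "(\<lambda>\<omega>. pulls \<omega> i t) \<in> measurable (run_space K t) (count_space UNIV)" for i
    by (rule measurable_pulls) simp
  have [measurable]: "(\<lambda>\<omega>. emp_mean \<omega> i t) \<in> borel_measurable (run_space K t)" if "i \<in> {1..K}" for i
  proof -
    have [measurable]: "(\<lambda>\<omega>. reward_sum \<omega> i t) \<in> borel_measurable (run_space K t)"
      using that by (intro measurable_reward_sum) auto
    show ?thesis unfolding emp_mean_eq by measurable
  qed
  have setsN: "sets ?N = sets ?B" by (simp cong: sets_PiM_cong)
  have "prob_space ?N"
    by (intro prob_space_PiM prob_space_gaussian) simp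
  then have N: "?N \<in> space (subprob_algebra ?B)"
    using setsN by (simp add: space_subprob_algebra prob_space_imp_subprob_space)
  have Z: "null_measure ?B \<in> space (subprob_algebra ?B)"
    by (auto simp: space_subprob_algebra space_PiM intro!: subprob_spaceI) (auto simp: PiE_eq_empty_iff)
  have "(\<lambda>\<omega>. if \<forall>i\<in>{1..K}. pulls \<omega> i t > 0
      then distr ?N ?B (\<lambda>z. \<lambda>i\<in>{1..K}. emp_mean \<omega> i t + sqrt (1 / real (pulls \<omega> i t)) * z i)
      else null_measure ?B) \<in> measurable (run_space K t) (subprob_algebra ?B)"
    (is "?g \<in> _")
  proof (rule measurable_If)
    show "(\<lambda>\<omega>. distr ?N ?B (\<lambda>z. \<lambda>i\<in>{1..K}. emp_mean \<omega> i t + sqrt (1 / real (pulls \<omega> i t)) * z i))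
        \<in> measurable (run_space K t) (subprob_algebra ?B)"
    proof (rule measurable_distr2)
      show "(\<lambda>\<omega>. ?N) \<in> measurable (run_space K t) (subprob_algebra ?B)"
        using N by (rule measurable_const)
      show "(\<lambda>(\<omega>, z). \<lambda>i\<in>{1..K}. emp_mean \<omega> i t + sqrt (1 / real (pulls \<omega> i t)) * z i)
          \<in> measurable (run_space K t \<Otimes>\<^sub>M ?B) ?B"
        by measurable
    qed
    show "(\<lambda>\<omega>. null_measure ?B) \<in> measurable (run_space K t) (subprob_algebra ?B)"
      using Z by (rule measurable_const)
    show "{\<omega> \<in> space (run_space K t). \<forall>i\<in>{1..K}. 0 < pulls \<omega> i t} \<in> sets (run_space K t)"
      by measurable
  qed
  also have "?g = ts_samples K (Suc t)"
  proof
    fix \<omega>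
    show "?g \<omega> = ts_samples K (Suc t) \<omega>"
    proof (cases "\<forall>i\<in>{1..K}. pulls \<omega> i t > 0")
      case True
      then show ?thesis
        unfolding ts_samples_def
        by (subst PiM_gaussian_eq_distr) auto
    next
      case False
      then obtain i where "i \<in> {1..K}" "pulls \<omega> i t = 0" by auto
      then show ?thesis
        unfolding ts_samples_def using False
        by (subst PiM_gaussian_eq_null_measure[where i = i]) auto
    qed
  qed
  finally show ?thesis .
qed

definition best :: "nat \<Rightarrow> (nat set \<Rightarrow> nat) \<Rightarrow> (nat \<Rightarrow> real) \<Rightarrow> nat" where
  "best K brk \<theta> = brk {i. is_arg_max \<theta> (\<lambda>i. i \<in> {1..K}) i}"

text \<open>\<open>brk\<close> is an arbitrary function on sets. The composition is measurable
  because the set of maximisers takes only finitely many values, each on a measurable set of sample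
  vectors.\<close>

lemma measurable_best: "best K brk \<in> measurable (\<Pi>\<^sub>M i\<in>{1..K}. borel) (count_space UNIV)"
proof -
  let ?B = "\<Pi>\<^sub>M i\<in>{1..K}. (borel :: real measure)"
  let ?S = "\<lambda>\<theta>::nat \<Rightarrow> real. {i. is_arg_max \<theta> (\<lambda>i. i \<in> {1..K}) i}"
  have "?S \<in> measurable ?B (count_space (Pow {1..K}))"
  proof (subst measurable_count_space_eq2)
    show "finite (Pow {1..K})" by simp
    have [measurable]: "Measurable.pred ?B (\<lambda>\<theta>. \<theta> j \<le> \<theta> i)" if "i \<in> {1..K}" "j \<in> {1..K}" for i j
      unfolding pred_def using that by (intro borel_measurable_le measurable_component_singleton)
    have "?S -` {S} \<inter> space ?B \<in> sets ?B" if "S \<in> Pow {1..K}" for S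
    proof -
      have "?S -` {S} \<inter> space ?B =
          {\<theta> \<in> space ?B. \<forall>i\<in>{1..K}. i \<in> S \<longleftrightarrow> (\<forall>j\<in>{1..K}. \<theta> j \<le> \<theta> i)}"
        using that by (auto simp: is_arg_max_def set_eq_iff not_less Ball_def)
      also have "\<dots> \<in> sets ?B" by measurable
      finally show ?thesis .
    qed
    then show "?S \<in> space ?B \<rightarrow> Pow {1..K} \<and> (\<forall>a\<in>Pow {1..K}. ?S -` {a} \<inter> space ?B \<in> sets ?B)"
      by (auto simp: is_arg_max_def)
  qed
  then have "(\<lambda>\<theta>. brk (?S \<theta>)) \<in> measurable ?B (count_space UNIV)"
    by (rule measurable_compose) simp
  then show ?thesis
    by (simp add: best_def[abs_def])
qed

lemma sets_ts_samples: "sets (ts_samples K (Suc t) \<omega>) = sets (\<Pi>\<^sub>M i\<in>{1..K}. borel)"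
  unfolding ts_samples_def by (rule sets_PiM_cong) auto

lemma measurable_best_samples:
  "best K brk \<in> measurable (ts_samples K (Suc t) \<omega>) (count_space UNIV)"
  unfolding measurable_cong_sets[OF sets_ts_samples refl] by (rule measurable_best)

lemma ts_choice_eq_distr:
  assumes "K \<le> t"
  shows "ts_choice K init brk (Suc t) \<omega> = distr (ts_samples K (Suc t) \<omega>) (count_space UNIV) (best K brk)"
proof -
  have "space (ts_samples K (Suc t) \<omega>) \<noteq> {}"
    by (auto simp: ts_samples_def space_PiM PiE_eq_empty_iff)
  from bind_return_distr'[OF this measurable_best_samples] show ?thesis
    using assms unfolding ts_choice_def best_def[symmetric] by simp
qed

lemma measurable_ts_choice:
  "ts_choice K init brk (Suc t) \<in> measurable (run_space K t) (subprob_algebra (count_space UNIV))"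
proof (cases "K \<le> t")
  case True
  then have "ts_choice K init brk (Suc t) =
      (\<lambda>\<omega>. distr (ts_samples K (Suc t) \<omega>) (count_space UNIV) (best K brk))"
    by (intro ext ts_choice_eq_distr)
  then show ?thesis
    by (simp only: measurable_compose[OF measurable_ts_samples measurable_distr[OF measurable_best]])
next
  case False
  then show ?thesis
    by (simp add: ts_choice_def[abs_def] space_subprob_algebra prob_space_imp_subprob_space prob_space_return)
qed

lemma space_run_space_upd:
  assumes "\<omega> \<in> space (run_space K t)" "x \<in> space (\<Pi>\<^sub>M i\<in>{1..K}. borel)"
  shows "(fun_upd \<omega> (Suc t) (i, x)) \<in> space (run_space K (Suc t))"
  using assms by (auto simp: run_space_def space_PiM space_pair_measure PiE_iff extensional_def)

lemma measurable_run_upd: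
  "(\<lambda>(\<omega>, x, i). (fun_upd \<omega> (Suc t) (i, x))) \<in>
     measurable (run_space K t \<Otimes>\<^sub>M (\<Pi>\<^sub>M i\<in>{1..K}. borel) \<Otimes>\<^sub>M count_space UNIV) (run_space K (Suc t))"
proof -
  have "{1..Suc t} = insert (Suc t) {1..t}" by auto
  then show ?thesis
    unfolding run_space_def by simp
qed

section \<open>Conditional pull probabilities and the one-step recursion of the law\<close>

locale thompson =
  fixes K :: nat and p :: "nat \<Rightarrow> real measure" and D :: "(nat \<Rightarrow> real) measure"
    and init :: "nat \<Rightarrow> nat" and brk :: "nat set \<Rightarrow> nat"
  assumes bandit: "bandit K p D" and params: "ts_params K init brk"
begin

abbreviation "law \<equiv> ts_run K D init brk"

text \<open>The index \<open>t\<close> is the length of the history, so this is the conditional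
  probability of a pull in round \<open>Suc t\<close>.\<close>

definition pick :: "nat \<Rightarrow> run \<Rightarrow> nat \<Rightarrow> ennreal" where
  "pick t \<omega> i = emeasure (ts_choice K init brk (Suc t) \<omega>) {i}"

lemma K_ge_2: "K \<ge> 2"
  using bandit by (simp add: bandit_def)

lemma prob_space_p: "i \<in> {1..K} \<Longrightarrow> prob_space (p i)"
  using bandit by (simp add: bandit_def)

lemma sets_p [measurable_cong]: "i \<in> {1..K} \<Longrightarrow> sets (p i) = sets borel"
  using bandit by (simp add: bandit_def)

lemma AE_p: "i \<in> {1..K} \<Longrightarrow> AE x in p i. 0 \<le> x \<and> x \<le> 1"
  using bandit by (simp add: bandit_def)

lemma prob_space_D: "prob_space D"
  using bandit by (simp add: bandit_def)

lemma sets_D [measurable_cong]: "sets D = sets (\<Pi>\<^sub>M i\<in>{1..K}. borel)"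
  using bandit by (simp add: bandit_def)

lemma space_D: "space D = space (\<Pi>\<^sub>M i\<in>{1..K}. borel)"
  by (rule sets_eq_imp_space_eq) (rule sets_D)

lemma distr_D: "i \<in> {1..K} \<Longrightarrow> distr D borel (\<lambda>x. x i) = p i"
  using bandit by (simp add: bandit_def)

lemma measurable_pick [measurable]: "(\<lambda>\<omega>. pick t \<omega> i) \<in> borel_measurable (run_space K t)"
  unfolding pick_def
  by (rule measurable_compose[OF measurable_ts_choice measurable_emeasure_subprob_algebra]) simp

lemma D_subprob: "D \<in> space (subprob_algebra (\<Pi>\<^sub>M i\<in>{1..K}. borel))"
  using sets_D prob_space_D by (simp add: space_subprob_algebra prob_space_imp_subprob_space)

lemma measurable_round:
  "(\<lambda>\<omega>. D \<bind> (\<lambda>x. ts_choice K init brk (Suc t) \<omega> \<bind>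
      (\<lambda>i. return (run_space K (Suc t)) ((fun_upd \<omega> (Suc t) (i, x))))))
    \<in> measurable (run_space K t) (subprob_algebra (run_space K (Suc t)))"
proof (rule measurable_bind)
  show "(\<lambda>\<omega>. D) \<in> measurable (run_space K t) (subprob_algebra (\<Pi>\<^sub>M i\<in>{1..K}. borel))"
    using D_subprob by (rule measurable_const)
  show "(\<lambda>z. ts_choice K init brk (Suc t) (fst z) \<bind>
      (\<lambda>i. return (run_space K (Suc t)) ((fun_upd (fst z) (Suc t) (i, snd z)))))
    \<in> measurable (run_space K t \<Otimes>\<^sub>M (\<Pi>\<^sub>M i\<in>{1..K}. borel)) (subprob_algebra (run_space K (Suc t)))"
  proof (rule measurable_bind)
    show "(\<lambda>z. ts_choice K init brk (Suc t) (fst z)) \<in> measurable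
        (run_space K t \<Otimes>\<^sub>M (\<Pi>\<^sub>M i\<in>{1..K}. borel)) (subprob_algebra (count_space UNIV))"
      by (rule measurable_compose[OF measurable_fst measurable_ts_choice])
    have "(\<lambda>z. (\<lambda>(\<omega>, x, i). (fun_upd \<omega> (Suc t) (i, x))) (fst (fst z), snd (fst z), snd z))
      \<in> measurable ((run_space K t \<Otimes>\<^sub>M (\<Pi>\<^sub>M i\<in>{1..K}. borel)) \<Otimes>\<^sub>M count_space UNIV) (run_space K (Suc t))"
      by (rule measurable_compose[OF _ measurable_run_upd]) measurable
    then show "(\<lambda>z. return (run_space K (Suc t)) ((fun_upd (fst (fst z)) (Suc t) (snd z, snd (fst z)))))
      \<in> measurable ((run_space K t \<Otimes>\<^sub>M (\<Pi>\<^sub>M i\<in>{1..K}. borel)) \<Otimes>\<^sub>M count_space UNIV)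
         (subprob_algebra (run_space K (Suc t)))"
      by (intro measurable_compose[OF _ return_measurable]) simp
  qed
qed

text \<open>At this stage only a subprobability: the sampling kernel loses its mass on histories
  with an unpulled arm. That such histories are null after the initial rounds is shown later, giving
  \<open>prob_space_law\<close>.\<close>

lemma subprob_law: "law t \<in> space (subprob_algebra (run_space K t))"
proof (induction t)
  case 0
  then show ?case
    by (auto simp: space_subprob_algebra run_space_def space_PiM
        intro!: prob_space_imp_subprob_space prob_space_return)
next
  case (Suc t)
  have "(\<lambda>M. M \<bind> (\<lambda>\<omega>. D \<bind> (\<lambda>x. ts_choice K init brk (Suc t) \<omega> \<bind>
      (\<lambda>i. return (run_space K (Suc t)) ((fun_upd \<omega> (Suc t) (i, x)))))))
    \<in> measurable (subprob_algebra (run_space K t)) (subprob_algebra (run_space K (Suc t)))"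
    by (rule measurable_bind2[OF measurable_ident_sets measurable_round]) simp
  from measurable_space[OF this Suc] show ?case by simp
qed

lemma sets_law [measurable_cong]: "sets (law t) = sets (run_space K t)"
  using subprob_law by (simp add: space_subprob_algebra)

lemma space_law: "space (law t) = space (run_space K t)"
  by (rule sets_eq_imp_space_eq) (rule sets_law)

lemma brk_in: "S \<subseteq> {1..K} \<Longrightarrow> S \<noteq> {} \<Longrightarrow> brk S \<in> S"
  using params by (simp add: ts_params_def)

lemma best_arg_max:
  shows "best K brk \<theta> \<in> {1..K}" and "j \<in> {1..K} \<Longrightarrow> \<theta> j \<le> \<theta> (best K brk \<theta>)"
proof -
  have "finite (\<theta> ` {1..K})" "\<theta> ` {1..K} \<noteq> {}" using K_ge_2 by auto
  from Max_in[OF this] obtain i where i: "i \<in> {1..K}" "\<theta> i = Max (\<theta> ` {1..K})" by force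
  then have "is_arg_max \<theta> (\<lambda>i. i \<in> {1..K}) i"
    using Max_ge[OF \<open>finite (\<theta> ` {1..K})\<close>] by (auto simp: is_arg_max_def not_less)
  then have "best K brk \<theta> \<in> {i. is_arg_max \<theta> (\<lambda>i. i \<in> {1..K}) i}"
    unfolding best_def by (intro brk_in) (auto simp: is_arg_max_def)
  then show "best K brk \<theta> \<in> {1..K}" and "j \<in> {1..K} \<Longrightarrow> \<theta> j \<le> \<theta> (best K brk \<theta>)"
    by (auto simp: is_arg_max_def not_less)
qed

lemma init_in: "t \<in> {1..K} \<Longrightarrow> init t \<in> {1..K}"
  using params bij_betwE[of init "{1..K}" "{1..K}"] unfolding ts_params_def by blast

lemma pick_early:
  assumes "t < K"
  shows "pick t \<omega> i = of_bool (init (Suc t) = i)"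
  using assms by (simp add: pick_def ts_choice_def indicator_def)

lemma pick_late:
  assumes "K \<le> t"
  shows "pick t \<omega> i = emeasure (ts_samples K (Suc t) \<omega>)
    {\<theta> \<in> space (ts_samples K (Suc t) \<omega>). best K brk \<theta> = i}"
  using assms
  by (simp add: pick_def ts_choice_eq_distr emeasure_distr[OF measurable_best_samples] vimage_def Int_def conj_commute)

lemma AE_ts_choice: "AE i in ts_choice K init brk (Suc t) \<omega>. i \<in> {1..K}"
proof (cases "K \<le> t")
  case True
  then show ?thesis
    unfolding ts_choice_eq_distr[OF True]
    by (subst AE_distr_iff[OF measurable_best_samples]) (use best_arg_max(1) in auto)
next
  case False
  then have "ts_choice K init brk (Suc t) \<omega> = return (count_space UNIV) (init (Suc t))"
    by (simp add: ts_choice_def)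
  then show ?thesis
    using False init_in[of "Suc t"] by (simp only:) (subst AE_return, auto)
qed

lemma nn_integral_ts_choice:
  "(\<integral>\<^sup>+i. f i \<partial>ts_choice K init brk (Suc t) \<omega>) = (\<Sum>i\<in>{1..K}. pick t \<omega> i * f i)"
proof -
  have [measurable_cong]: "sets (ts_choice K init brk (Suc t) \<omega>) = sets (count_space UNIV)"
    by (cases "K \<le> t") (simp add: ts_choice_eq_distr, simp add: ts_choice_def)
  have "(\<integral>\<^sup>+i. f i \<partial>ts_choice K init brk (Suc t) \<omega>) =
      (\<integral>\<^sup>+i. (\<Sum>j\<in>{1..K}. f j * indicator {j} i) \<partial>ts_choice K init brk (Suc t) \<omega>)"
    by (intro nn_integral_cong_AE eventually_mono[OF AE_ts_choice])
       (simp add: indicator_def sum.delta' if_distrib[where f = "\<lambda>x. _ * x"] cong: if_cong)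
  also have "\<dots> = (\<Sum>i\<in>{1..K}. pick t \<omega> i * f i)"
    by (subst nn_integral_sum) (auto simp: nn_integral_cmult_indicator pick_def mult.commute)
  finally show ?thesis .
qed

lemma sum_pick_le_1:
  assumes "\<omega> \<in> space (run_space K t)"
  shows "(\<Sum>i\<in>{1..K}. pick t \<omega> i) \<le> 1"
proof -
  have "subprob_space (ts_choice K init brk (Suc t) \<omega>)"
    using measurable_space[OF measurable_ts_choice assms] by (simp add: space_subprob_algebra)
  from subprob_space.emeasure_space_le_1[OF this] show ?thesis
    using nn_integral_ts_choice[of t \<omega> "\<lambda>_. 1"] by simp
qed

lemma measurable_upd [measurable (raw)]:
  assumes "f \<in> measurable M (run_space K t)" "g \<in> measurable M (\<Pi>\<^sub>M i\<in>{1..K}. borel)"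
  shows "(\<lambda>z. (fun_upd (f z) (Suc t) (i, g z))) \<in> measurable M (run_space K (Suc t))"
  using measurable_compose[OF _ measurable_run_upd, of "\<lambda>z. (f z, g z, i)" M K t] assms by simp

text \<open>Given the history, the arm and the reward vector of a round are independent, so the
  reward integral separates from \<open>pick\<close>. Every expectation under \<open>law\<close> is
  computed through this recursion.\<close>

lemma nn_integral_law_Suc:
  assumes F[measurable]: "F \<in> borel_measurable (run_space K (Suc t))"
  shows "(\<integral>\<^sup>+\<omega>. F \<omega> \<partial>law (Suc t)) =
    (\<integral>\<^sup>+\<omega>. (\<Sum>i\<in>{1..K}. pick t \<omega> i * (\<integral>\<^sup>+x. F ((fun_upd \<omega> (Suc t) (i, x))) \<partial>D)) \<partial>law t)"
proof -
  let ?C = "ts_choice K init brk (Suc t)"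
  have "(\<integral>\<^sup>+\<omega>. F \<omega> \<partial>law (Suc t)) =
      (\<integral>\<^sup>+\<omega>. (\<integral>\<^sup>+\<omega>'. F \<omega>' \<partial>(D \<bind> (\<lambda>x. ?C \<omega> \<bind> (\<lambda>i. return (run_space K (Suc t)) ((fun_upd \<omega> (Suc t) (i, x))))))) \<partial>law t)"
    unfolding ts_run.simps(2)
    by (rule nn_integral_bind[OF F]) (use measurable_round in measurable)
  also have "\<dots> = (\<integral>\<^sup>+\<omega>. (\<Sum>i\<in>{1..K}. pick t \<omega> i * (\<integral>\<^sup>+x. F ((fun_upd \<omega> (Suc t) (i, x))) \<partial>D)) \<partial>law t)"
  proof (rule nn_integral_cong)
    fix \<omega> assume "\<omega> \<in> space (law t)"
    then have w: "\<omega> \<in> space (run_space K t)" by (simp add: space_law)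
    have [measurable]: "(\<lambda>i. (fun_upd \<omega> (Suc t) (i, x))) \<in> measurable (count_space UNIV) (run_space K (Suc t))"
      if "x \<in> space D" for x
      using space_run_space_upd[OF w] that by (simp add: space_D)
    have C: "?C \<omega> \<in> space (subprob_algebra (count_space UNIV))"
      by (rule measurable_space[OF measurable_ts_choice w])
    have "(\<integral>\<^sup>+\<omega>'. F \<omega>' \<partial>(D \<bind> (\<lambda>x. ?C \<omega> \<bind> (\<lambda>i. return (run_space K (Suc t)) ((fun_upd \<omega> (Suc t) (i, x)))))))
       = (\<integral>\<^sup>+x. (\<integral>\<^sup>+\<omega>'. F \<omega>' \<partial>(?C \<omega> \<bind> (\<lambda>i. return (run_space K (Suc t)) ((fun_upd \<omega> (Suc t) (i, x)))))) \<partial>D)"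
    proof (rule nn_integral_bind[OF F])
      have "(\<lambda>x. ?C \<omega> \<bind> (\<lambda>i. return (run_space K (Suc t)) ((fun_upd \<omega> (Suc t) (i, x)))))
         \<in> measurable (\<Pi>\<^sub>M i\<in>{1..K}. borel) (subprob_algebra (run_space K (Suc t)))"
      proof (rule measurable_bind)
        show "(\<lambda>x. ?C \<omega>) \<in> measurable (\<Pi>\<^sub>M i\<in>{1..K}. borel) (subprob_algebra (count_space UNIV))"
          using C by (rule measurable_const)
        have "(\<lambda>z. (\<lambda>(\<omega>, x, i). (fun_upd \<omega> (Suc t) (i, x))) (\<omega>, fst z, snd z))
          \<in> measurable ((\<Pi>\<^sub>M i\<in>{1..K}. borel) \<Otimes>\<^sub>M count_space UNIV) (run_space K (Suc t))"
          using w by (intro measurable_compose[OF _ measurable_run_upd]) measurable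
        then show "(\<lambda>z. return (run_space K (Suc t)) ((fun_upd \<omega> (Suc t) (snd z, fst z))))
          \<in> measurable ((\<Pi>\<^sub>M i\<in>{1..K}. borel) \<Otimes>\<^sub>M count_space UNIV) (subprob_algebra (run_space K (Suc t)))"
          by (intro measurable_compose[OF _ return_measurable]) simp
      qed
      then show "(\<lambda>x. ?C \<omega> \<bind> (\<lambda>i. return (run_space K (Suc t)) ((fun_upd \<omega> (Suc t) (i, x)))))
         \<in> measurable D (subprob_algebra (run_space K (Suc t)))"
        by (simp cong: measurable_cong_sets add: sets_D)
    qed
    also have "\<dots> = (\<integral>\<^sup>+x. (\<Sum>i\<in>{1..K}. pick t \<omega> i * F ((fun_upd \<omega> (Suc t) (i, x)))) \<partial>D)"
    proof (rule nn_integral_cong)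
      fix x assume x: "x \<in> space D"
      have "(\<integral>\<^sup>+\<omega>'. F \<omega>' \<partial>(?C \<omega> \<bind> (\<lambda>i. return (run_space K (Suc t)) ((fun_upd \<omega> (Suc t) (i, x))))))
        = (\<integral>\<^sup>+i. (\<integral>\<^sup>+\<omega>'. F \<omega>' \<partial>return (run_space K (Suc t)) ((fun_upd \<omega> (Suc t) (i, x)))) \<partial>?C \<omega>)"
      proof (rule nn_integral_bind[OF F])
        have "sets (?C \<omega>) = sets (count_space UNIV)" using C by (simp add: space_subprob_algebra)
        then show "(\<lambda>i. return (run_space K (Suc t)) ((fun_upd \<omega> (Suc t) (i, x))))
          \<in> measurable (?C \<omega>) (subprob_algebra (run_space K (Suc t)))"
          using space_run_space_upd[OF w] x
          by (subst measurable_cong_sets[where M' = "count_space UNIV" and N' = "subprob_algebra (run_space K (Suc t))"])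
             (auto simp: space_D space_subprob_algebra intro!: prob_space_imp_subprob_space prob_space_return)
      qed
      also have "\<dots> = (\<integral>\<^sup>+i. F ((fun_upd \<omega> (Suc t) (i, x))) \<partial>?C \<omega>)"
        using space_run_space_upd[OF w] x
        by (intro nn_integral_cong nn_integral_return F) (simp add: space_D)
      finally show "(\<integral>\<^sup>+\<omega>'. F \<omega>' \<partial>(?C \<omega> \<bind> (\<lambda>i. return (run_space K (Suc t)) ((fun_upd \<omega> (Suc t) (i, x))))))
        = (\<Sum>i\<in>{1..K}. pick t \<omega> i * F ((fun_upd \<omega> (Suc t) (i, x))))"
        by (simp only: nn_integral_ts_choice)
    qed
    also have "\<dots> = (\<Sum>i\<in>{1..K}. pick t \<omega> i * (\<integral>\<^sup>+x. F ((fun_upd \<omega> (Suc t) (i, x))) \<partial>D))"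
      using w by (subst nn_integral_sum) (auto simp: nn_integral_cmult intro!: sum.cong)
    finally show "(\<integral>\<^sup>+\<omega>'. F \<omega>' \<partial>(D \<bind> (\<lambda>x. ?C \<omega> \<bind> (\<lambda>i. return (run_space K (Suc t)) ((fun_upd \<omega> (Suc t) (i, x)))))))
      = (\<Sum>i\<in>{1..K}. pick t \<omega> i * (\<integral>\<^sup>+x. F ((fun_upd \<omega> (Suc t) (i, x))) \<partial>D))" .
  qed
  finally show ?thesis .
qed

text \<open>If arm \<open>i\<close> wins, either its own sample exceeds \<open>y\<close> (box
  \<open>?A\<close>) or all samples are at most \<open>y\<close> (box \<open>?B\<close>). The box
  \<open>?C\<close> differs from \<open>?B\<close> only in coordinate 1, where it asks for more than
  \<open>y\<close>; by independence the two probabilities differ exactly by the odds of arm 1. On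
  \<open>?C\<close> arm 1 is the strict maximiser, whatever \<open>brk\<close> does.\<close>

lemma pick_le:
  assumes t: "K \<le> t" and pos: "\<And>j. j \<in> {1..K} \<Longrightarrow> pulls \<omega> j t > 0"
    and i: "i \<in> {1..K}" "i \<noteq> 1" and d: "d \<ge> 0"
  shows "pick t \<omega> i \<le> emeasure (gaussian (emp_mean \<omega> i t) (1 / real (pulls \<omega> i t))) {y<..}
    + ennreal (3 * exp (3 / 2 * (y + d - emp_mean \<omega> 1 t)\<^sup>2 * real (pulls \<omega> 1 t) - d\<^sup>2 / 4 * real (pulls \<omega> 1 t)))
      * pick t \<omega> 1"
    (is "_ \<le> _ + ?c * _")
proof -
  define g where "g = (\<lambda>j. gaussian (emp_mean \<omega> j t) (1 / real (pulls \<omega> j t)))"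
  define M where "M = ts_samples K (Suc t) \<omega>"
  have M: "M = Pi\<^sub>M {1..K} g" by (simp add: M_def ts_samples_def g_def)
  interpret product_sigma_finite g
    unfolding g_def by (rule product_sigma_finite_gaussian) simp
  have K1: "1 \<in> {1..K}" using K_ge_2 by auto
  have setsM: "sets M = sets (\<Pi>\<^sub>M i\<in>{1..K}. borel)"
    unfolding M_def by (rule sets_ts_samples)
  have spaceM: "space M = (\<Pi>\<^sub>E i\<in>{1..K}. UNIV)"
    using sets_eq_imp_space_eq[OF setsM] by (simp add: space_PiM)
  have box: "Pi\<^sub>E {1..K} A \<in> sets M" if "\<And>j. j \<in> {1..K} \<Longrightarrow> A j \<in> sets borel" for A
    unfolding setsM using that by (intro sets_PiM_I_finite) auto
  have em: "emeasure M (Pi\<^sub>E {1..K} A) = (\<Prod>j\<in>{1..K}. emeasure (g j) (A j))"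
    if "\<And>j. j \<in> {1..K} \<Longrightarrow> A j \<in> sets borel" for A
    unfolding M using that by (intro emeasure_PiM) (auto simp: g_def)
  have g1: "emeasure (g j) UNIV = 1" if "j \<in> {1..K}" for j
    using prob_space.emeasure_space_1[OF prob_space_gaussian, of "1 / real (pulls \<omega> j t)"] pos[OF that]
    by (simp add: g_def)
  let ?A = "\<Pi>\<^sub>E j\<in>{1..K}. if j = i then {y<..} else UNIV"
  let ?B = "\<Pi>\<^sub>E j\<in>{1..K}. {..y}"
  let ?C = "\<Pi>\<^sub>E j\<in>{1..K}. if j = 1 then {y<..} else {..y}"
  have best_meas: "{\<theta> \<in> space M. best K brk \<theta> = j} \<in> sets M" for j
    using measurable_sets[OF measurable_best_samples, of "{j}" K brk t \<omega>]
    by (simp add: M_def vimage_def Int_def conj_commute)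
  have "{\<theta> \<in> space M. best K brk \<theta> = i} \<subseteq> ?A \<union> ?B"
  proof
    fix \<theta> assume \<theta>: "\<theta> \<in> {\<theta> \<in> space M. best K brk \<theta> = i}"
    show "\<theta> \<in> ?A \<union> ?B"
    proof (cases "\<theta> i \<le> y")
      case True
      then have "\<theta> j \<le> y" if "j \<in> {1..K}" for j
        using best_arg_max(2)[OF that, of \<theta>] \<theta> by simp
      then show ?thesis using \<theta> by (auto simp: spaceM PiE_iff)
    next
      case False
      then show ?thesis using \<theta> by (auto simp: spaceM PiE_iff)
    qed
  qed
  then have "pick t \<omega> i \<le> emeasure M (?A \<union> ?B)"
    unfolding pick_late[OF t] M_def[symmetric] by (intro emeasure_mono sets.Un box) auto
  also have "\<dots> \<le> emeasure M ?A + emeasure M ?B"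
    by (intro emeasure_subadditive box) auto
  also have "emeasure M ?A = (\<Prod>j\<in>{1..K}. if j = i then emeasure (g i) {y<..} else 1)"
    by (subst em) (auto intro!: prod.cong simp: g1 simp del: prod.delta prod.delta')
  also have "\<dots> = emeasure (g i) {y<..}"
    using i by (simp add: prod.delta)
  also have "emeasure M ?B = emeasure (g 1) {..y} * (\<Prod>j\<in>{1..K}-{1}. emeasure (g j) {..y})"
    using K1 by (subst em) (auto intro: prod.remove)
  also have "\<dots> \<le> (?c * emeasure (g 1) {y<..}) * (\<Prod>j\<in>{1..K}-{1}. emeasure (g j) {..y})"
    using gaussian_odds_le[of "1 / real (pulls \<omega> 1 t)" d "emp_mean \<omega> 1 t" y] pos[OF K1] d
    by (intro mult_right_mono) (auto simp: g_def)
  also have "\<dots> = ?c * (emeasure (g 1) {y<..} * (\<Prod>j\<in>{1..K}-{1}. emeasure (g j) {..y}))"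
    by (simp add: mult.assoc)
  also have "emeasure (g 1) {y<..} * (\<Prod>j\<in>{1..K}-{1}. emeasure (g j) {..y}) =
      (\<Prod>j\<in>{1..K}. emeasure (g j) (if j = 1 then {y<..} else {..y}))"
    by (subst prod.remove[OF _ K1]) (auto intro!: arg_cong2[where f = "(*)"] prod.cong)
  also have "\<dots> = emeasure M ?C"
    by (subst em) auto
  also have "emeasure M ?C \<le> pick t \<omega> 1"
    unfolding pick_late[OF t] M_def[symmetric]
  proof (intro emeasure_mono best_meas subsetI)
    fix \<theta> assume \<theta>: "\<theta> \<in> ?C"
    have "best K brk \<theta> = 1"
    proof (rule ccontr)
      assume "best K brk \<theta> \<noteq> 1"
      then have "\<theta> (best K brk \<theta>) \<le> y"
        using PiE_mem[OF \<theta> best_arg_max(1)[of \<theta>]] by simp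
      moreover have "\<theta> 1 > y" using PiE_mem[OF \<theta> K1] by simp
      ultimately show False using best_arg_max(2)[OF K1, of \<theta>] by simp
    qed
    then show "\<theta> \<in> {\<theta> \<in> space M. best K brk \<theta> = 1}"
      using \<theta> by (auto simp: spaceM PiE_iff)
  qed
  finally show ?thesis
    by (simp add: g_def add_left_mono mult_left_mono)
qed

end

section \<open>Costs charged to the pulls of an arm\<close>

lemma pulls_upd_old: "s \<le> t \<Longrightarrow> pulls (fun_upd \<omega> (Suc t) z) j s = pulls \<omega> j s"
  by (auto simp: pulls_def arm_def intro!: sum.cong)

lemma reward_sum_upd_old: "s \<le> t \<Longrightarrow> reward_sum (fun_upd \<omega> (Suc t) z) j s = reward_sum \<omega> j s"
  by (auto simp: reward_sum_def arm_def reward_def intro!: sum.cong)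

lemma pulls_upd: "pulls (fun_upd \<omega> (Suc t) (i, x)) j (Suc t) = pulls \<omega> j t + of_bool (i = j)"
  using pulls_upd_old[of t t \<omega> "(i, x)" j] by (simp add: pulls_def arm_def)

lemma reward_sum_upd:
  "reward_sum (fun_upd \<omega> (Suc t) (i, x)) j (Suc t) = reward_sum \<omega> j t + of_bool (i = j) * x j"
  using reward_sum_upd_old[of t t \<omega> "(i, x)" j] by (simp add: reward_sum_def arm_def reward_def)

text \<open>Each pull of arm \<open>j\<close> pays \<open>f\<close>, evaluated at the pull count and
  reward total just before it. The charge is thus determined by the history preceding the pull, and
  a charge restricted to count \<open>s\<close> is paid at most once.\<close>

definition cost :: "nat \<Rightarrow> (nat \<Rightarrow> real \<Rightarrow> ennreal) \<Rightarrow> nat \<Rightarrow> run \<Rightarrow> ennreal" where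
  "cost j f t \<omega> = (\<Sum>q\<in>{1..t}. of_bool (arm \<omega> q = j) * f (pulls \<omega> j (q - 1)) (reward_sum \<omega> j (q - 1)))"

lemma cost_upd_old: "s \<le> t \<Longrightarrow> cost j f s (fun_upd \<omega> (Suc t) z) = cost j f s \<omega>"
  by (auto simp: cost_def arm_def pulls_upd_old reward_sum_upd_old intro!: sum.cong)

lemma cost_upd:
  "cost j f (Suc t) (fun_upd \<omega> (Suc t) (i, x)) =
     cost j f t \<omega> + of_bool (i = j) * f (pulls \<omega> j t) (reward_sum \<omega> j t)"
  using cost_upd_old[of t t j f \<omega> "(i, x)"]
  by (simp add: cost_def arm_def pulls_upd_old reward_sum_upd_old)

lemma measurable_statistic:
  fixes f :: "nat \<Rightarrow> real \<Rightarrow> ennreal"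
  assumes f[measurable]: "\<And>n. f n \<in> borel_measurable borel" and "s \<le> t" "j \<in> {1..K}"
  shows "(\<lambda>\<omega>. f (pulls \<omega> j s) (reward_sum \<omega> j s)) \<in> borel_measurable (run_space K t)"
proof (rule measurable_compose_countable[where f = "\<lambda>n \<omega>. f n (reward_sum \<omega> j s)"])
  have [measurable]: "(\<lambda>\<omega>. reward_sum \<omega> j s) \<in> borel_measurable (run_space K t)"
    using assms by (intro measurable_reward_sum)
  show "(\<lambda>\<omega>. f n (reward_sum \<omega> j s)) \<in> borel_measurable (run_space K t)" for n
    by measurable
  show "(\<lambda>\<omega>. pulls \<omega> j s) \<in> measurable (run_space K t) (count_space UNIV)"
    using assms by (intro measurable_pulls)
qed

lemma measurable_cost:
  fixes f :: "nat \<Rightarrow> real \<Rightarrow> ennreal"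
  assumes f: "\<And>n. f n \<in> borel_measurable borel" and "s \<le> t" "j \<in> {1..K}"
  shows "cost j f s \<in> borel_measurable (run_space K t)"
  unfolding cost_def[abs_def]
proof (rule borel_measurable_sum)
  fix q assume q: "q \<in> {1..s}"
  have [measurable]: "(\<lambda>\<omega>. arm \<omega> q) \<in> measurable (run_space K t) (count_space UNIV)"
    using q assms by (intro measurable_arm) auto
  have [measurable]: "(\<lambda>\<omega>. f (pulls \<omega> j (q - 1)) (reward_sum \<omega> j (q - 1))) \<in> borel_measurable (run_space K t)"
    using q assms by (intro measurable_statistic) auto
  show "(\<lambda>\<omega>. of_bool (arm \<omega> q = j) * f (pulls \<omega> j (q - 1)) (reward_sum \<omega> j (q - 1))) \<in> borel_measurable (run_space K t)"
    by measurable
qed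

section \<open>Almost sure initialisation, total mass, and the recursion for costs\<close>

context thompson
begin

text \<open>Induction step for almost sure invariants. Arms of zero conditional probability are
  exempt, which is how \<open>AE_init\<close> learns that an initial round pulls the prescribed
  arm.\<close>

lemma AE_law_Suc:
  assumes P: "Measurable.pred (run_space K (Suc t)) P"
    and ae: "AE \<omega> in law t. \<forall>i\<in>{1..K}. pick t \<omega> i \<noteq> 0 \<longrightarrow> (AE x in D. P (fun_upd \<omega> (Suc t) (i, x)))"
  shows "AE \<omega> in law (Suc t). P \<omega>"
proof -
  have P'[measurable]: "Measurable.pred (law (Suc t)) P"
    using P unfolding measurable_cong_sets[OF sets_law refl] .
  have ind: "indicator {\<omega>. \<not> P \<omega>} \<in> borel_measurable (run_space K (Suc t))"
    using P by measurable
  have "(\<integral>\<^sup>+\<omega>. indicator {\<omega>. \<not> P \<omega>} \<omega> \<partial>law (Suc t)) =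
    (\<integral>\<^sup>+\<omega>. (\<Sum>i\<in>{1..K}. pick t \<omega> i * (\<integral>\<^sup>+x. indicator {\<omega>. \<not> P \<omega>} (fun_upd \<omega> (Suc t) (i, x)) \<partial>D)) \<partial>law t)"
    by (rule nn_integral_law_Suc[OF ind])
  also have "\<dots> = (\<integral>\<^sup>+\<omega>. 0 \<partial>law t)"
  proof (rule nn_integral_cong_AE, rule eventually_mono[OF ae])
    fix \<omega>
    assume *: "\<forall>i\<in>{1..K}. pick t \<omega> i \<noteq> 0 \<longrightarrow> (AE x in D. P (fun_upd \<omega> (Suc t) (i, x)))"
    have "pick t \<omega> i * (\<integral>\<^sup>+x. indicator {\<omega>. \<not> P \<omega>} (fun_upd \<omega> (Suc t) (i, x)) \<partial>D) = 0"
      if i: "i \<in> {1..K}" for i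
    proof (cases "pick t \<omega> i = 0")
      case False
      with * i have "AE x in D. P (fun_upd \<omega> (Suc t) (i, x))" by blast
      then have "(\<integral>\<^sup>+x. indicator {\<omega>. \<not> P \<omega>} (fun_upd \<omega> (Suc t) (i, x)) \<partial>D) = (\<integral>\<^sup>+x. 0 \<partial>D)"
        by (intro nn_integral_cong_AE) (auto elim!: eventually_mono)
      then show ?thesis by simp
    qed simp
    then show "(\<Sum>i\<in>{1..K}. pick t \<omega> i * (\<integral>\<^sup>+x. indicator {\<omega>. \<not> P \<omega>} (fun_upd \<omega> (Suc t) (i, x)) \<partial>D)) = 0"
      by simp
  qed
  finally have "(\<integral>\<^sup>+\<omega>. indicator {\<omega>. \<not> P \<omega>} \<omega> \<partial>law (Suc t)) = 0"
    by (simp only: nn_integral_const mult_zero_left)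
  then show ?thesis
    by (intro AE_iff_nn_integral[THEN iffD2] predE P')
qed

lemma AE_init: "AE \<omega> in law t. \<forall>q\<in>{1..min t K}. arm \<omega> q = init q"
proof (induction t)
  case (Suc t)
  have [measurable]: "(\<lambda>\<omega>. arm \<omega> q) \<in> measurable (run_space K (Suc t)) (count_space UNIV)"
    if "q \<in> {1..min (Suc t) K}" for q
    using that by (intro measurable_arm) auto
  show ?case
  proof (rule AE_law_Suc, measurable, rule eventually_mono[OF Suc], intro ballI impI)
    fix \<omega> i
    assume w: "\<forall>q\<in>{1..min t K}. arm \<omega> q = init q" and i: "i \<in> {1..K}" "pick t \<omega> i \<noteq> 0"
    have "arm (fun_upd \<omega> (Suc t) (i, x)) q = init q" if "q \<in> {1..min (Suc t) K}" for q x
    proof (cases "q = Suc t")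
      case True
      then show ?thesis
        using i that pick_early[of t \<omega> i] by (auto simp: arm_def split: if_splits)
    next
      case False
      then show ?thesis
        using w that by (simp add: arm_def)
    qed
    then show "AE x in D. \<forall>q\<in>{1..min (Suc t) K}. arm (fun_upd \<omega> (Suc t) (i, x)) q = init q"
      by simp
  qed
qed simp

lemma pulls_pos:
  assumes "\<forall>q\<in>{1..min t K}. arm \<omega> q = init q" "K \<le> t" "j \<in> {1..K}"
  shows "pulls \<omega> j t > 0"
proof -
  have "bij_betw init {1..K} {1..K}" using params by (simp add: ts_params_def)
  then have "j \<in> init ` {1..K}" using assms by (simp add: bij_betw_def)
  then obtain q where q: "q \<in> {1..K}" "init q = j" by blast
  have "of_bool (arm \<omega> q = j) \<le> pulls \<omega> j t"
    unfolding pulls_def using q assms by (intro member_le_sum) auto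
  then show ?thesis using q assms by (auto simp: min_def)
qed

text \<open>Initial pulls find no earlier pull of their arm, so a charge restricted to pulls with at
  least \<open>l > 0\<close> predecessors ignores them.\<close>

lemma pulls_init_eq_0:
  assumes "\<forall>q\<in>{1..min t K}. arm \<omega> q = init q" "t < K"
  shows "pulls \<omega> (init (Suc t)) t = 0"
proof -
  have "inj_on init {1..K}" using params by (simp add: ts_params_def bij_betw_def)
  then have "init q \<noteq> init (Suc t)" if "q \<in> {1..t}" for q
    using that assms(2) inj_on_eq_iff[of init "{1..K}" q "Suc t"] by auto
  then show ?thesis using assms by (auto simp: pulls_def)
qed

lemma sum_pick_eq_1:
  assumes "\<And>j. K \<le> t \<Longrightarrow> j \<in> {1..K} \<Longrightarrow> pulls \<omega> j t > 0"
  shows "(\<Sum>i\<in>{1..K}. pick t \<omega> i) = 1"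
proof -
  have "prob_space (ts_choice K init brk (Suc t) \<omega>)"
  proof (cases "K \<le> t")
    case True
    have "prob_space (ts_samples K (Suc t) \<omega>)"
      unfolding ts_samples_def using assms[OF True]
      by (intro prob_space_PiM prob_space_gaussian) simp
    then show ?thesis
      unfolding ts_choice_eq_distr[OF True]
      by (rule prob_space.prob_space_distr) (rule measurable_best_samples)
  next
    case False
    then show ?thesis by (simp add: ts_choice_def prob_space_return)
  qed
  from prob_space.emeasure_space_1[OF this] show ?thesis
    using nn_integral_ts_choice[of t \<omega> "\<lambda>_. 1"] by simp
qed

lemma AE_sum_pick_eq_1: "AE \<omega> in law t. (\<Sum>i\<in>{1..K}. pick t \<omega> i) = 1"
  by (rule eventually_mono[OF AE_init]) (intro sum_pick_eq_1 pulls_pos)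

lemma emeasure_D_space [simp]: "emeasure D (space D) = 1"
  by (rule prob_space.emeasure_space_1[OF prob_space_D])

lemma prob_space_law: "prob_space (law t)"
proof (induction t)
  case 0
  then show ?case
    by (auto simp: run_space_def space_PiM intro!: prob_space_return)
next
  case (Suc t)
  have "(\<integral>\<^sup>+\<omega>. 1 \<partial>law (Suc t)) =
      (\<integral>\<^sup>+\<omega>. (\<Sum>i\<in>{1..K}. pick t \<omega> i * (\<integral>\<^sup>+x. 1 \<partial>D)) \<partial>law t)"
    by (rule nn_integral_law_Suc) simp
  also have "\<dots> = (\<integral>\<^sup>+\<omega>. 1 \<partial>law t)"
    by (intro nn_integral_cong_AE eventually_mono[OF AE_sum_pick_eq_1]) simp
  also have "\<dots> = 1"
    using prob_space.emeasure_space_1[OF Suc] by simp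
  finally show ?case by (intro prob_spaceI) simp
qed

lemma borel_measurable_law: "borel_measurable (law t) = borel_measurable (run_space K t)"
  by (rule measurable_cong_sets[OF sets_law refl])

text \<open>Exchanges conditional probabilities for actual pulls: a statistic weighted by
  \<open>pick\<close> is the expected growth of the corresponding cost. In this way the comparison
  with the probability of pulling arm 1 becomes a charge on real pulls of arm 1.\<close>

lemma nn_integral_cost_Suc:
  assumes f: "\<And>n. f n \<in> borel_measurable borel" and j: "j \<in> {1..K}"
  shows "(\<integral>\<^sup>+\<omega>. cost j f (Suc t) \<omega> \<partial>law (Suc t)) =
    (\<integral>\<^sup>+\<omega>. cost j f t \<omega> \<partial>law t)
    + (\<integral>\<^sup>+\<omega>. pick t \<omega> j * f (pulls \<omega> j t) (reward_sum \<omega> j t) \<partial>law t)"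
proof -
  have [measurable]: "cost j f t \<in> borel_measurable (law t)"
    "(\<lambda>\<omega>. f (pulls \<omega> j t) (reward_sum \<omega> j t)) \<in> borel_measurable (law t)"
    "(\<lambda>\<omega>. pick t \<omega> j) \<in> borel_measurable (law t)"
    unfolding borel_measurable_law using assms by (auto intro: measurable_cost measurable_statistic)
  have "(\<integral>\<^sup>+\<omega>. cost j f (Suc t) \<omega> \<partial>law (Suc t)) =
      (\<integral>\<^sup>+\<omega>. (\<Sum>i\<in>{1..K}. pick t \<omega> i * (cost j f t \<omega>
         + of_bool (i = j) * f (pulls \<omega> j t) (reward_sum \<omega> j t))) \<partial>law t)"
    using assms by (subst nn_integral_law_Suc) (auto simp: cost_upd intro: measurable_cost)
  also have "\<dots> = (\<integral>\<^sup>+\<omega>. (\<Sum>i\<in>{1..K}. pick t \<omega> i) * cost j f t \<omega>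
      + pick t \<omega> j * f (pulls \<omega> j t) (reward_sum \<omega> j t) \<partial>law t)"
    using j by (intro nn_integral_cong)
      (simp add: distrib_left sum.distrib sum_distrib_right of_bool_def if_distrib[where f = "\<lambda>x. x * _"]
        if_distrib[where f = "\<lambda>x. _ * x"] sum.delta cong: if_cong)
  also have "\<dots> = (\<integral>\<^sup>+\<omega>. cost j f t \<omega> + pick t \<omega> j * f (pulls \<omega> j t) (reward_sum \<omega> j t) \<partial>law t)"
    by (intro nn_integral_cong_AE eventually_mono[OF AE_sum_pick_eq_1]) simp
  also have "\<dots> = (\<integral>\<^sup>+\<omega>. cost j f t \<omega> \<partial>law t)
      + (\<integral>\<^sup>+\<omega>. pick t \<omega> j * f (pulls \<omega> j t) (reward_sum \<omega> j t) \<partial>law t)"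
    by (rule nn_integral_add) measurable
  finally show ?thesis .
qed

section \<open>Exponential bounds along the pulls of one arm\<close>

lemma nn_integral_p:
  assumes "j \<in> {1..K}" "f \<in> borel_measurable borel"
  shows "(\<integral>\<^sup>+x. f (x j) \<partial>D) = (\<integral>\<^sup>+x. f x \<partial>p j)"
proof -
  have "(\<lambda>x. x j) \<in> measurable D borel"
    unfolding measurable_cong_sets[OF sets_D refl] using assms(1) by (rule measurable_component_singleton)
  then show ?thesis
    unfolding distr_D[OF assms(1), symmetric] using assms(2) by (subst nn_integral_distr) auto
qed

lemma interval_p: "j \<in> {1..K} \<Longrightarrow> interval_bounded_random_variable (p j) (\<lambda>x. x) 0 1"
  using prob_space_p[of j] AE_p[of j] sets_p[of j]
  by (auto simp: interval_bounded_random_variable_def interval_bounded_random_variable_axioms_def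
      intro!: measurable_ident_sets)

text \<open>Hoeffding's lemma for an interval of length 1. Negative \<open>l\<close> is reduced to
  positive by reflecting the rewards; both signs are needed because \<open>l\<close> is later
  averaged over a centred Gaussian.\<close>

lemma exp_moment_le:
  assumes j: "j \<in> {1..K}"
  shows "(\<integral>\<^sup>+x. ennreal (exp (l * (x - mean (p j)))) \<partial>p j) \<le> ennreal (exp (l\<^sup>2 / 8))"
proof -
  interpret interval_bounded_random_variable "p j" "\<lambda>x. x" 0 1 by (rule interval_p[OF j])
  consider "l > 0" | "l = 0" | "l < 0" by linarith
  then show ?thesis
  proof cases
    case 1
    from Hoeffdings_lemma_nn_integral[OF this] show ?thesis
      by (simp add: mean_def)
  next
    case 2
    then show ?thesis using emeasure_space_1 by simp
  next
    case 3
    interpret neg: interval_bounded_random_variable "p j" "\<lambda>x. - x" "-1" 0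
      using AE_in_interval by unfold_locales (auto elim!: eventually_mono)
    from neg.Hoeffdings_lemma_nn_integral[of "- l"] 3 show ?thesis
      by (simp add: mean_def algebra_simps)
  qed
qed

text \<open>
  The potential \<open>U\<close> below dominates the conditional expectation of what is still to be paid: the
  exponential is a supermartingale along the pulls of arm \<open>j\<close>, and it is collected once, at the
  pull that finds \<open>s\<close> earlier ones.
\<close>

lemma nn_integral_cost_exp_le:
  assumes j: "j \<in> {1..K}"
  shows "(\<integral>\<^sup>+\<omega>. cost j (\<lambda>n S. of_bool (n = s) * ennreal (exp (l * (S - real s * mean (p j))))) t \<omega> \<partial>law t)
    \<le> ennreal (exp (l\<^sup>2 * real s / 8))"
proof -
  define f where "f = (\<lambda>n S. of_bool (n = s) * ennreal (exp (l * (S - real s * mean (p j)))))"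
  define U where "U = (\<lambda>n S. of_bool (n \<le> s) *
    ennreal (exp (l * (S - real n * mean (p j)) + l\<^sup>2 * (real s - real n) / 8)))"
  have f[measurable]: "f n \<in> borel_measurable borel" and U[measurable]: "U n \<in> borel_measurable borel" for n
    unfolding f_def U_def by measurable
  \<comment> \<open>For \<open>n < s\<close>, Hoeffding's lemma consumes one unit
    \<open>l^2 / 8\<close> of the exponent reserved for the \<open>s - n\<close> pulls still to
    come. For \<open>n = s\<close> the charge is all of \<open>U\<close>, and \<open>U\<close> is
    zero after the pull. For \<open>n > s\<close> both terms vanish.\<close>
  have pay: "f n S + (\<integral>\<^sup>+x. U (n + 1) (S + x j) \<partial>D) \<le> U n S" for n S
  proof -
    consider "n < s" | "n = s" | "n > s" by linarith
    then show ?thesis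
    proof cases
      case 1
      let ?c = "exp (l * (S - real n * mean (p j)) + l\<^sup>2 * (real s - real n - 1) / 8)"
      have "(\<integral>\<^sup>+x. U (n + 1) (S + x j) \<partial>D) = (\<integral>\<^sup>+x. U (n + 1) (S + x) \<partial>p j)"
        by (rule nn_integral_p[OF j]) measurable
      also have "\<dots> = (\<integral>\<^sup>+x. ennreal ?c * ennreal (exp (l * (x - mean (p j)))) \<partial>p j)"
        using 1 by (intro nn_integral_cong) (simp add: U_def algebra_simps flip: ennreal_mult exp_add)
      also have "\<dots> = ennreal ?c * (\<integral>\<^sup>+x. ennreal (exp (l * (x - mean (p j)))) \<partial>p j)"
        using sets_p[OF j] by (intro nn_integral_cmult) (simp cong: measurable_cong_sets)
      also have "\<dots> \<le> ennreal ?c * ennreal (exp (l\<^sup>2 / 8))"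
        by (intro mult_left_mono exp_moment_le j) simp
      also have "\<dots> = U n S"
        using 1 by (simp add: U_def diff_divide_distrib algebra_simps flip: ennreal_mult exp_add)
      finally show ?thesis using 1 by (simp add: f_def)
    qed (simp_all add: f_def U_def)
  qed
  have "(\<integral>\<^sup>+\<omega>. cost j f t \<omega> + U (pulls \<omega> j t) (reward_sum \<omega> j t) \<partial>law t) \<le> ennreal (exp (l\<^sup>2 * real s / 8))"
  proof (induction t)
    case 0
    have "(\<lambda>_. undefined) \<in> space (run_space K 0)"
      by (simp add: run_space_def space_PiM)
    moreover have "(\<lambda>\<omega>. cost j f 0 \<omega> + U (pulls \<omega> j 0) (reward_sum \<omega> j 0)) \<in> borel_measurable (run_space K 0)"
      by (intro borel_measurable_add measurable_cost measurable_statistic f U j) simp_all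
    ultimately show ?case
      by (simp add: nn_integral_return) (simp add: cost_def pulls_def reward_sum_def U_def)
  next
    case (Suc t)
    let ?G = "\<lambda>\<omega>. cost j f t \<omega> + U (pulls \<omega> j t) (reward_sum \<omega> j t)"
    have "(\<integral>\<^sup>+\<omega>. cost j f (Suc t) \<omega> + U (pulls \<omega> j (Suc t)) (reward_sum \<omega> j (Suc t)) \<partial>law (Suc t)) =
      (\<integral>\<^sup>+\<omega>. (\<Sum>i\<in>{1..K}. pick t \<omega> i * (\<integral>\<^sup>+x. cost j f t \<omega> + of_bool (i = j) * f (pulls \<omega> j t) (reward_sum \<omega> j t)
         + U (pulls \<omega> j t + of_bool (i = j)) (reward_sum \<omega> j t + of_bool (i = j) * x j) \<partial>D)) \<partial>law t)"
      by (subst nn_integral_law_Suc)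
         (simp_all only: cost_upd pulls_upd reward_sum_upd borel_measurable_add measurable_cost measurable_statistic f U j order_refl)
    also have "\<dots> \<le> (\<integral>\<^sup>+\<omega>. ?G \<omega> \<partial>law t)"
    proof (rule nn_integral_mono)
      fix \<omega> assume "\<omega> \<in> space (law t)"
      then have w: "\<omega> \<in> space (run_space K t)" by (simp add: space_law)
      have [measurable]: "(\<lambda>x. x j) \<in> measurable D borel"
        unfolding measurable_cong_sets[OF sets_D refl] using j by (rule measurable_component_singleton)
      have "(\<integral>\<^sup>+x. cost j f t \<omega> + of_bool (i = j) * f (pulls \<omega> j t) (reward_sum \<omega> j t)
         + U (pulls \<omega> j t + of_bool (i = j)) (reward_sum \<omega> j t + of_bool (i = j) * x j) \<partial>D) \<le> ?G \<omega>" for i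
      proof (cases "i = j")
        case True
        then show ?thesis
          using pay[of "pulls \<omega> j t" "reward_sum \<omega> j t"]
          by (simp add: nn_integral_add add.assoc add_left_mono)
      qed simp
      then have "(\<Sum>i\<in>{1..K}. pick t \<omega> i * (\<integral>\<^sup>+x. cost j f t \<omega> + of_bool (i = j) * f (pulls \<omega> j t) (reward_sum \<omega> j t)
         + U (pulls \<omega> j t + of_bool (i = j)) (reward_sum \<omega> j t + of_bool (i = j) * x j) \<partial>D))
        \<le> (\<Sum>i\<in>{1..K}. pick t \<omega> i * ?G \<omega>)"
        by (intro sum_mono mult_left_mono) auto
      also have "\<dots> = (\<Sum>i\<in>{1..K}. pick t \<omega> i) * ?G \<omega>"
        by (rule sum_distrib_right[symmetric])
      also have "\<dots> \<le> 1 * ?G \<omega>"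
        by (intro mult_right_mono sum_pick_le_1 w) simp
      finally show "(\<Sum>i\<in>{1..K}. pick t \<omega> i * (\<integral>\<^sup>+x. cost j f t \<omega> + of_bool (i = j) * f (pulls \<omega> j t) (reward_sum \<omega> j t)
         + U (pulls \<omega> j t + of_bool (i = j)) (reward_sum \<omega> j t + of_bool (i = j) * x j) \<partial>D)) \<le> ?G \<omega>"
        by simp
    qed
    also note Suc
    finally show ?case .
  qed
  then show ?thesis
    \<comment> \<open>The potential left at time \<open>t\<close> is discarded; it belongs to runs
      in which arm \<open>j\<close> has not yet paid.\<close>
    unfolding f_def[symmetric] by (rule order_trans[rotated]) (intro nn_integral_mono, simp)
qed

end

section \<open>Splitting a cost by the number of earlier pulls\<close>

lemma sum_exp_le:
  fixes r :: real
  assumes "r > 0"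
  shows "(\<Sum>s<T. exp (- r * real s)) \<le> 1 + 1 / r"
proof -
  have "exp (- r) * (1 + r) \<le> exp (- r) * exp r"
    using exp_ge_add_one_self[of r] by (intro mult_left_mono) auto
  then have e: "exp (- r) * (1 + r) \<le> 1" by (simp flip: exp_add)
  have pos: "0 < 1 - exp (- r)" using assms by simp
  have "(\<Sum>s<T. exp (- r * real s)) = (\<Sum>s<T. exp (- r) ^ s)"
    by (simp add: exp_of_nat_mult[symmetric] mult.commute)
  also have "\<dots> = (1 - exp (- r) ^ T) / (1 - exp (- r))"
    using assms by (simp add: sum_gp_strict)
  also have "\<dots> \<le> 1 / (1 - exp (- r))"
    using pos by (intro divide_right_mono) auto
  also have "\<dots> \<le> 1 + 1 / r"
    using pos e assms by (simp add: field_simps)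
  finally show ?thesis .
qed

lemma pulls_le: "pulls \<omega> j t \<le> t"
proof -
  have "pulls \<omega> j t \<le> (\<Sum>q\<in>{1..t}. 1)"
    unfolding pulls_def by (intro sum_mono) simp
  then show ?thesis by simp
qed

lemma pulls_Suc: "pulls \<omega> j (Suc t) = pulls \<omega> j t + of_bool (arm \<omega> (Suc t) = j)"
  by (simp add: pulls_def)

lemma cost_Suc:
  "cost j f (Suc t) \<omega> = cost j f t \<omega> + of_bool (arm \<omega> (Suc t) = j) * f (pulls \<omega> j t) (reward_sum \<omega> j t)"
  by (simp add: cost_def)

lemma cost_mono: "(\<And>n S. f n S \<le> g n S) \<Longrightarrow> cost j f t \<omega> \<le> cost j g t \<omega>"
  unfolding cost_def by (intro sum_mono mult_left_mono) auto

text \<open>Only counts \<open>s < T\<close> occur, because a pull in round \<open>q \<le> T\<close>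
  has at most \<open>q - 1\<close> predecessors. This replaces the random pull count by fixed values
  \<open>s\<close>, for which the exponential bounds are stated.\<close>

lemma cost_split: "cost j f T \<omega> = (\<Sum>s<T. cost j (\<lambda>n S. of_bool (n = s) * f s S) T \<omega>)"
proof -
  have "(\<Sum>s<T. of_bool (pulls \<omega> j (q - 1) = s) * f s (reward_sum \<omega> j (q - 1)))
      = f (pulls \<omega> j (q - 1)) (reward_sum \<omega> j (q - 1))" if "q \<in> {1..T}" for q
  proof -
    have "pulls \<omega> j (q - 1) < T"
      using pulls_le[of \<omega> j "q - 1"] that by auto
    then show ?thesis
      by (simp add: of_bool_def if_distrib[where f = "\<lambda>x. x * _"] cong: if_cong)
  qed
  then show ?thesis
    unfolding cost_def by (subst sum.swap) (simp flip: sum_distrib_left)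
qed

lemma cost_cmult: "cost j (\<lambda>n S. c * f n S) t \<omega> = c * cost j f t \<omega>"
  unfolding cost_def sum_distrib_left by (intro sum.cong refl mult.left_commute)

lemma pulls_eq_cost: "of_nat (pulls \<omega> j t) = cost j (\<lambda>_ _. 1) t \<omega>"
  by (simp add: pulls_def cost_def)

lemma cost_late: "cost j (\<lambda>n _. of_bool (l \<le> n)) t \<omega> = of_nat (pulls \<omega> j t - l)"
proof (induction t)
  case 0
  then show ?case by (simp add: cost_def pulls_def)
next
  case (Suc t)
  then show ?case
    by (cases "l \<le> pulls \<omega> j t"; cases "arm \<omega> (Suc t) = j")
       (simp_all add: cost_Suc pulls_Suc Suc_diff_le add.commute)
qed

lemma pulls_le_cost_late: "of_nat (pulls \<omega> j t) \<le> of_nat l + cost j (\<lambda>n _. of_bool (l \<le> n)) t \<omega>"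
  unfolding cost_late of_nat_add[symmetric] by (rule of_nat_mono) simp

context thompson
begin

abbreviation \<mu> :: "nat \<Rightarrow> real" where "\<mu> i \<equiv> mean (p i)"

lemma measurable_cost_law:
  fixes f :: "nat \<Rightarrow> real \<Rightarrow> ennreal"
  assumes "\<And>n. f n \<in> borel_measurable borel" "j \<in> {1..K}"
  shows "cost j f t \<in> borel_measurable (law t)"
  unfolding borel_measurable_law using assms by (intro measurable_cost) auto

lemma nn_integral_cost_split:
  fixes f :: "nat \<Rightarrow> real \<Rightarrow> ennreal"
  assumes f: "\<And>n. f n \<in> borel_measurable borel" and j: "j \<in> {1..K}"
  shows "(\<integral>\<^sup>+\<omega>. cost j f T \<omega> \<partial>law T) = (\<Sum>s<T. \<integral>\<^sup>+\<omega>. cost j (\<lambda>n S. of_bool (n = s) * f s S) T \<omega> \<partial>law T)"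
  by (subst cost_split) (intro nn_integral_sum measurable_cost_law j borel_measurable_times_ennreal borel_measurable_const f)

lemma sum_ennreal_exp_le:
  assumes "c \<ge> 0" "r > 0"
  shows "(\<Sum>s<T. ennreal (c * exp (- r * real s))) \<le> ennreal (c * (1 + 1 / r))"
proof -
  have "(\<Sum>s<T. ennreal (c * exp (- r * real s))) = ennreal (c * (\<Sum>s<T. exp (- r * real s)))"
    using assms by (subst sum_ennreal) (auto simp: sum_distrib_left)
  also have "\<dots> \<le> ennreal (c * (1 + 1 / r))"
    using assms by (intro ennreal_leI mult_left_mono sum_exp_le) auto
  finally show ?thesis .
qed

text \<open>A Chernoff bound for each fixed number \<open>s\<close> of earlier pulls, followed by a
  geometric sum. The result is independent of \<open>T\<close>, since pulls are charged and not
  rounds.\<close>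

lemma overestimation_le:
  assumes j: "j \<in> {1..K}" and d: "d > 0"
  shows "(\<integral>\<^sup>+\<omega>. cost j (\<lambda>n S. of_bool (real n * (\<mu> j + d) < S)) T \<omega> \<partial>law T) \<le> ennreal (1 + 1 / (2 * d\<^sup>2))"
proof -
  have "(\<integral>\<^sup>+\<omega>. cost j (\<lambda>n S. of_bool (real n * (\<mu> j + d) < S)) T \<omega> \<partial>law T) =
    (\<Sum>s<T. \<integral>\<^sup>+\<omega>. cost j (\<lambda>n S. of_bool (n = s) * of_bool (real s * (\<mu> j + d) < S)) T \<omega> \<partial>law T)"
    using j by (intro nn_integral_cost_split) measurable
  also have "\<dots> \<le> (\<Sum>s<T. ennreal (1 * exp (- (2 * d\<^sup>2) * real s)))"
  proof (rule sum_mono)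
    fix s
    \<comment> \<open>\<open>4 * d\<close> minimises the Chernoff exponent
      \<open>l^2 / 8 - l * d\<close>, and the minimum is \<open>- 2 * d^2\<close>.\<close>
    let ?f = "\<lambda>n S. of_bool (n = s) * ennreal (exp (4 * d * (S - real s * \<mu> j)))"
    let ?c = "ennreal (exp (- 4 * d\<^sup>2 * real s))"
    have "of_bool (n = s) * of_bool (real s * (\<mu> j + d) < S) \<le> ?c * ?f n S" for n S
    proof (cases "real s * (\<mu> j + d) < S")
      case True
      then have "4 * d * (real s * (\<mu> j + d)) \<le> 4 * d * S"
        using d by (intro mult_left_mono) auto
      then have "1 \<le> exp (- 4 * d\<^sup>2 * real s + 4 * d * (S - real s * \<mu> j))"
        by (simp add: algebra_simps power2_eq_square)
      then have "1 \<le> ennreal (exp (- 4 * d\<^sup>2 * real s + 4 * d * (S - real s * \<mu> j)))"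
        by (rule ennreal_ge_1[THEN iffD2])
      also have "\<dots> = ?c * ennreal (exp (4 * d * (S - real s * \<mu> j)))"
        unfolding exp_add by (rule ennreal_mult) auto
      finally have "1 \<le> ?c * ennreal (exp (4 * d * (S - real s * \<mu> j)))" .
      then show ?thesis using True by (cases "n = s") simp_all
    qed simp
    then have "(\<integral>\<^sup>+\<omega>. cost j (\<lambda>n S. of_bool (n = s) * of_bool (real s * (\<mu> j + d) < S)) T \<omega> \<partial>law T)
      \<le> (\<integral>\<^sup>+\<omega>. cost j (\<lambda>n S. ?c * ?f n S) T \<omega> \<partial>law T)"
      by (intro nn_integral_mono cost_mono)
    also have "\<dots> = (\<integral>\<^sup>+\<omega>. ?c * cost j ?f T \<omega> \<partial>law T)"
      by (simp only: cost_cmult)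
    also have "\<dots> = ?c * (\<integral>\<^sup>+\<omega>. cost j ?f T \<omega> \<partial>law T)"
      using j by (intro nn_integral_cmult measurable_cost_law) measurable
    also have "\<dots> \<le> ?c * ennreal (exp ((4 * d)\<^sup>2 * real s / 8))"
      by (intro mult_left_mono nn_integral_cost_exp_le j) simp
    also have "\<dots> = ennreal (1 * exp (- (2 * d\<^sup>2) * real s))"
      by (simp add: power_mult_distrib flip: ennreal_mult exp_add)
    finally show "(\<integral>\<^sup>+\<omega>. cost j (\<lambda>n S. of_bool (n = s) * of_bool (real s * (\<mu> j + d) < S)) T \<omega> \<partial>law T)
      \<le> ennreal (1 * exp (- (2 * d\<^sup>2) * real s))" .
  qed
  also have "\<dots> \<le> ennreal (1 * (1 + 1 / (2 * d\<^sup>2)))"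
    using d by (intro sum_ennreal_exp_le) auto
  finally show ?thesis by simp
qed

text \<open>
  The exponent is quadratic in the deviation of \<open>S\<close>, so it is written as a Gaussian mixture of
  the linear exponents covered by \<open>nn_integral_cost_exp_le\<close>.
\<close>

lemma nn_integral_cost_exp_square_le:
  assumes j: "j \<in> {1..K}"
  shows "(\<integral>\<^sup>+\<omega>. cost j (\<lambda>n S. of_bool (n = s) * ennreal (exp (3 / 2 * (S - real s * \<mu> j)\<^sup>2 / real s))) T \<omega> \<partial>law T) \<le> 2"
proof -
  \<comment> \<open>With this slope, averaging \<open>exp (l g * x)\<close> over a standard normal
    \<open>g\<close> yields \<open>exp (3 / 2 * x^2 / s)\<close>. For \<open>s = 0\<close> division
    by zero makes both exponents 0.\<close>
  define l where "l = (\<lambda>g. sqrt 3 * g / sqrt (real s))"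
  define E where "E = (\<lambda>\<omega> g. cost j (\<lambda>n S. of_bool (n = s) * ennreal (exp (l g * (S - real s * \<mu> j)))) T \<omega>)"
  interpret law: prob_space "law T" by (rule prob_space_law)
  interpret pair_sigma_finite "law T" "lborel :: real measure" ..
  have [measurable]: "(\<lambda>\<omega>. arm \<omega> q) \<in> measurable (law T) (count_space UNIV)"
    "(\<lambda>\<omega>. pulls \<omega> j (q - 1)) \<in> measurable (law T) (count_space UNIV)"
    "(\<lambda>\<omega>. reward_sum \<omega> j (q - 1)) \<in> borel_measurable (law T)" if "q \<in> {1..T}" for q
    unfolding measurable_cong_sets[OF sets_law refl] using that j
    by (auto intro!: measurable_arm measurable_pulls measurable_reward_sum)
  have E[measurable]: "case_prod E \<in> borel_measurable (law T \<Otimes>\<^sub>M lborel)"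
    unfolding E_def cost_def l_def by measurable
  have mix: "ennreal (exp (3 / 2 * (S - real s * \<mu> j)\<^sup>2 / real s)) =
      (\<integral>\<^sup>+g. ennreal (exp (l g * (S - real s * \<mu> j))) * ennreal (std_normal_density g) \<partial>lborel)" for S
  proof -
    let ?b = "sqrt 3 * (S - real s * \<mu> j) / sqrt (real s)"
    have "ennreal (exp (?b\<^sup>2 / 2)) = (\<integral>\<^sup>+g. ennreal (exp (?b * g)) * ennreal (std_normal_density g) \<partial>lborel)"
      by (rule nn_integral_exp_std_normal[symmetric])
    moreover have "?b\<^sup>2 / 2 = 3 / 2 * (S - real s * \<mu> j)\<^sup>2 / real s"
      by (simp add: power_divide power_mult_distrib)
    moreover have "?b * g = l g * (S - real s * \<mu> j)" for g
      by (simp add: l_def)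
    ultimately show ?thesis by simp
  qed
  have "cost j (\<lambda>n S. of_bool (n = s) * ennreal (exp (3 / 2 * (S - real s * \<mu> j)\<^sup>2 / real s))) T \<omega>
      = (\<integral>\<^sup>+g. E \<omega> g * ennreal (std_normal_density g) \<partial>lborel)" for \<omega>
  proof -
    have [measurable]: "l \<in> borel_measurable borel" unfolding l_def by measurable
    show ?thesis
      unfolding cost_def E_def mix sum_distrib_right mult.assoc
      by (subst nn_integral_sum) (auto simp: nn_integral_cmult intro!: sum.cong)
  qed
  then have "(\<integral>\<^sup>+\<omega>. cost j (\<lambda>n S. of_bool (n = s) * ennreal (exp (3 / 2 * (S - real s * \<mu> j)\<^sup>2 / real s))) T \<omega> \<partial>law T)
    = (\<integral>\<^sup>+\<omega>. (\<integral>\<^sup>+g. E \<omega> g * ennreal (std_normal_density g) \<partial>lborel) \<partial>law T)"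
    by simp
  also have "\<dots> = (\<integral>\<^sup>+g. (\<integral>\<^sup>+\<omega>. E \<omega> g * ennreal (std_normal_density g) \<partial>law T) \<partial>lborel)"
    by (rule Fubini'[symmetric]) measurable
  \<comment> \<open>After exchanging the integrals, the linear bound applies for each fixed
    \<open>g\<close> and gives \<open>exp (3 * g^2 / 8)\<close>. This is still integrable against
    the Gaussian weight because \<open>3/8 < 1/2\<close>.\<close>
  also have "\<dots> = (\<integral>\<^sup>+g. (\<integral>\<^sup>+\<omega>. E \<omega> g \<partial>law T) * ennreal (std_normal_density g) \<partial>lborel)"
    by (intro nn_integral_cong nn_integral_multc) measurable
  also have "\<dots> \<le> (\<integral>\<^sup>+g. ennreal (exp (3 * g\<^sup>2 / 8)) * ennreal (std_normal_density g) \<partial>lborel)"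
  proof (intro nn_integral_mono mult_right_mono)
    fix g :: real
    have "(\<integral>\<^sup>+\<omega>. E \<omega> g \<partial>law T) \<le> ennreal (exp ((l g)\<^sup>2 * real s / 8))"
      unfolding E_def by (rule nn_integral_cost_exp_le[OF j])
    also have "\<dots> \<le> ennreal (exp (3 * g\<^sup>2 / 8))"
      by (cases "s = 0") (auto simp: l_def power_divide power_mult_distrib intro!: ennreal_leI)
    finally show "(\<integral>\<^sup>+\<omega>. E \<omega> g \<partial>law T) \<le> ennreal (exp (3 * g\<^sup>2 / 8))" .
  qed simp
  also have "\<dots> = 2"
    by (rule nn_integral_exp_square_std_normal)
  finally show ?thesis .
qed

text \<open>The odds bound, charged to the pulls of the arm. For each \<open>s\<close> the
  square-exponential moment contributes at most 2, the odds contribute the factor 3, and the reserve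
  \<open>r\<close> makes the series geometric.\<close>

lemma underestimation_le:
  assumes j: "j \<in> {1..K}" and r: "r > 0"
  shows "(\<integral>\<^sup>+\<omega>. cost j (\<lambda>n S. ennreal (3 * exp (3 / 2 * (S - real n * \<mu> j)\<^sup>2 / real n - r * real n))) T \<omega> \<partial>law T)
    \<le> ennreal (6 * (1 + 1 / r))"
proof -
  let ?f = "\<lambda>s n S. of_bool (n = s) * ennreal (exp (3 / 2 * (S - real s * \<mu> j)\<^sup>2 / real s))"
  have "(\<integral>\<^sup>+\<omega>. cost j (\<lambda>n S. ennreal (3 * exp (3 / 2 * (S - real n * \<mu> j)\<^sup>2 / real n - r * real n))) T \<omega> \<partial>law T)
    = (\<Sum>s<T. \<integral>\<^sup>+\<omega>. cost j (\<lambda>n S. of_bool (n = s) * ennreal (3 * exp (3 / 2 * (S - real s * \<mu> j)\<^sup>2 / real s - r * real s))) T \<omega> \<partial>law T)"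
    using j by (intro nn_integral_cost_split) measurable
  also have "\<dots> \<le> (\<Sum>s<T. ennreal (6 * exp (- r * real s)))"
  proof (rule sum_mono)
    fix s
    let ?c = "ennreal (3 * exp (- r * real s))"
    have "of_bool (n = s) * ennreal (3 * exp (3 / 2 * (S - real s * \<mu> j)\<^sup>2 / real s - r * real s)) = ?c * ?f s n S" for n S
      by (cases "n = s") (simp_all add: mult_ac flip: ennreal_mult exp_add)
    then have "(\<integral>\<^sup>+\<omega>. cost j (\<lambda>n S. of_bool (n = s) * ennreal (3 * exp (3 / 2 * (S - real s * \<mu> j)\<^sup>2 / real s - r * real s))) T \<omega> \<partial>law T)
      = (\<integral>\<^sup>+\<omega>. ?c * cost j (?f s) T \<omega> \<partial>law T)"
      by (simp only: cost_cmult)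
    also have "\<dots> = ?c * (\<integral>\<^sup>+\<omega>. cost j (?f s) T \<omega> \<partial>law T)"
      using j by (intro nn_integral_cmult measurable_cost_law) measurable
    also have "\<dots> \<le> ?c * 2"
      by (intro mult_left_mono nn_integral_cost_exp_square_le j) simp
    also have "\<dots> = ennreal (6 * exp (- r * real s))"
      by (simp add: mult_ac flip: ennreal_mult'' ennreal_numeral)
    finally show "(\<integral>\<^sup>+\<omega>. cost j (\<lambda>n S. of_bool (n = s) * ennreal (3 * exp (3 / 2 * (S - real s * \<mu> j)\<^sup>2 / real s - r * real s))) T \<omega> \<partial>law T)
      \<le> ennreal (6 * exp (- r * real s))" .
  qed
  also have "\<dots> \<le> ennreal (6 * (1 + 1 / r))"
    using r by (intro sum_ennreal_exp_le) auto
  finally show ?thesis .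
qed

end

section \<open>Expected number of pulls\<close>

context thompson
begin

definition expected_pulls :: "nat \<Rightarrow> nat \<Rightarrow> ennreal" where
  "expected_pulls i t = (\<integral>\<^sup>+\<omega>. of_nat (pulls \<omega> i t) \<partial>law t)"

text \<open>Induction over rounds, comparing the growth of both sides. A late pull of
  \<open>i\<close> is paid by the same pull if \<open>i\<close> is overestimated, by a pull of arm 1
  weighted with its odds if all samples are low, and by a constant per round if only the sample of
  \<open>i\<close> is too high. The gap of \<open>3 * d\<close> provides one \<open>d\<close> for
  the error of the empirical mean of \<open>i\<close>, one for placing \<open>y\<close> below
  \<open>\<mu> 1\<close>, and at least one in between for the sample.\<close>

lemma late_pulls_le:
  assumes i: "i \<in> {1..K}" "i \<noteq> 1" and d: "d > 0" "3 * d \<le> \<mu> 1 - \<mu> i" and l: "l > 0"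
  shows "(\<integral>\<^sup>+\<omega>. cost i (\<lambda>n _. of_bool (l \<le> n)) T \<omega> \<partial>law T) \<le>
    (\<integral>\<^sup>+\<omega>. cost i (\<lambda>n S. of_bool (real n * (\<mu> i + d) < S)) T \<omega> \<partial>law T)
    + (\<integral>\<^sup>+\<omega>. cost 1 (\<lambda>n S. ennreal (3 * exp (3 / 2 * (S - real n * \<mu> 1)\<^sup>2 / real n - d\<^sup>2 / 4 * real n))) T \<omega> \<partial>law T)
    + ennreal (real T * exp (- real l * d\<^sup>2 / 2))"
    (is "?L T \<le> (\<integral>\<^sup>+\<omega>. cost i ?a T \<omega> \<partial>law T) + (\<integral>\<^sup>+\<omega>. cost 1 ?h T \<omega> \<partial>law T) + _")
proof (induction T)
  case 0
  then show ?case by (simp add: cost_def)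
next
  case (Suc t)
  have K1: "1 \<in> {1..K}" using K_ge_2 by auto
  have a: "?a n \<in> borel_measurable borel" and h: "?h n \<in> borel_measurable borel" for n
    by measurable
  let ?b = "ennreal (exp (- real l * d\<^sup>2 / 2))"
  have main: "pick t \<omega> i * of_bool (l \<le> pulls \<omega> i t) \<le>
      pick t \<omega> i * ?a (pulls \<omega> i t) (reward_sum \<omega> i t) + pick t \<omega> 1 * ?h (pulls \<omega> 1 t) (reward_sum \<omega> 1 t) + ?b"
    if w: "\<forall>q\<in>{1..min t K}. arm \<omega> q = init q" for \<omega>
  proof (cases "l \<le> pulls \<omega> i t \<and> \<not> real (pulls \<omega> i t) * (\<mu> i + d) < reward_sum \<omega> i t")
    case False
    then show ?thesis by (cases "l \<le> pulls \<omega> i t") (auto simp: add.assoc)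
  next
    case True
    show ?thesis
    proof (cases "K \<le> t")
      \<comment> \<open>In an initial round the only possible pull is that of
        \<open>init (Suc t)\<close>, which has no earlier pulls; \<open>l > 0\<close> then
        contradicts \<open>l \<le> pulls \<omega> i t\<close>.\<close>
      case False
      then have "pick t \<omega> i = 0"
        using True l pulls_init_eq_0[OF w] by (cases "init (Suc t) = i") (auto simp: pick_early)
      then show ?thesis by simp
    next
      case t: True
      let ?n = "real (pulls \<omega> i t)" and ?m = "real (pulls \<omega> 1 t)"
      have n: "?n > 0" and m: "?m > 0"
        using pulls_pos[OF w t] i K1 by auto
      have le: "emp_mean \<omega> i t \<le> \<mu> i + d"
        using True n by (simp add: emp_mean_eq field_simps)
      have "d \<le> \<mu> 1 - d - emp_mean \<omega> i t" using le d by simp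
      then have sq: "d\<^sup>2 \<le> (\<mu> 1 - d - emp_mean \<omega> i t)\<^sup>2" using d by (intro power_mono) auto
      \<comment> \<open>Passes from the empirical mean in the odds bound to the reward total used by
        \<open>cost\<close>; here \<open>y + d\<close> is exactly \<open>\<mu> 1\<close>.\<close>
      have eq: "3 / 2 * (\<mu> 1 - d + d - emp_mean \<omega> 1 t)\<^sup>2 * ?m = 3 / 2 * (reward_sum \<omega> 1 t - ?m * \<mu> 1)\<^sup>2 / ?m"
      proof -
        have "\<mu> 1 - d + d - emp_mean \<omega> 1 t = - (reward_sum \<omega> 1 t - ?m * \<mu> 1) / ?m"
          using m by (simp add: emp_mean_eq field_simps)
        then show ?thesis using m by (simp only: power_divide power2_minus) (simp add: power2_eq_square)
      qed
      have "pick t \<omega> i \<le> emeasure (gaussian (emp_mean \<omega> i t) (1 / ?n)) {\<mu> 1 - d<..}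
        + ennreal (3 * exp (3 / 2 * (\<mu> 1 - d + d - emp_mean \<omega> 1 t)\<^sup>2 * ?m - d\<^sup>2 / 4 * ?m)) * pick t \<omega> 1"
        using i d by (intro pick_le t pulls_pos[OF w t]) auto
      also note eq
      also have "emeasure (gaussian (emp_mean \<omega> i t) (1 / ?n)) {\<mu> 1 - d<..}
          \<le> ennreal (exp (- (\<mu> 1 - d - emp_mean \<omega> i t)\<^sup>2 / (2 * (1 / ?n))))"
        using n le d by (intro gaussian_upper_tail) auto
      also have "\<dots> \<le> ?b"
      proof (intro ennreal_leI, subst exp_le_cancel_iff)
        have "real l * d\<^sup>2 \<le> ?n * (\<mu> 1 - d - emp_mean \<omega> i t)\<^sup>2"
          using True sq by (intro mult_mono) auto
        then show "- (\<mu> 1 - d - emp_mean \<omega> i t)\<^sup>2 / (2 * (1 / ?n)) \<le> - real l * d\<^sup>2 / 2"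
          by (simp add: mult.commute)
      qed
      finally show ?thesis
        using True by (simp add: add.commute mult.commute mult.assoc add_right_mono)
    qed
  qed
  have [measurable]: "(\<lambda>\<omega>. pick t \<omega> j) \<in> borel_measurable (law t)" for j
    unfolding borel_measurable_law by measurable
  have [measurable]: "(\<lambda>\<omega>. ?a (pulls \<omega> i t) (reward_sum \<omega> i t)) \<in> borel_measurable (law t)"
    "(\<lambda>\<omega>. ?h (pulls \<omega> 1 t) (reward_sum \<omega> 1 t)) \<in> borel_measurable (law t)"
    unfolding borel_measurable_law
    by (intro measurable_statistic[of ?a] a order_refl i) (intro measurable_statistic[of ?h] h order_refl K1)
  let ?A = "\<integral>\<^sup>+\<omega>. pick t \<omega> i * ?a (pulls \<omega> i t) (reward_sum \<omega> i t) \<partial>law t"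
  let ?H = "\<integral>\<^sup>+\<omega>. pick t \<omega> 1 * ?h (pulls \<omega> 1 t) (reward_sum \<omega> 1 t) \<partial>law t"
  have "(\<integral>\<^sup>+\<omega>. pick t \<omega> i * of_bool (l \<le> pulls \<omega> i t) \<partial>law t) \<le>
    (\<integral>\<^sup>+\<omega>. pick t \<omega> i * ?a (pulls \<omega> i t) (reward_sum \<omega> i t) + pick t \<omega> 1 * ?h (pulls \<omega> 1 t) (reward_sum \<omega> 1 t) + ?b \<partial>law t)"
    by (intro nn_integral_mono_AE eventually_mono[OF AE_init] main)
  also have "\<dots> = (\<integral>\<^sup>+\<omega>. pick t \<omega> i * ?a (pulls \<omega> i t) (reward_sum \<omega> i t)
      + pick t \<omega> 1 * ?h (pulls \<omega> 1 t) (reward_sum \<omega> 1 t) \<partial>law t) + (\<integral>\<^sup>+\<omega>. ?b \<partial>law t)"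
    by (rule nn_integral_add) measurable
  also have "(\<integral>\<^sup>+\<omega>. pick t \<omega> i * ?a (pulls \<omega> i t) (reward_sum \<omega> i t)
      + pick t \<omega> 1 * ?h (pulls \<omega> 1 t) (reward_sum \<omega> 1 t) \<partial>law t) = ?A + ?H"
    by (rule nn_integral_add) measurable
  also have "(\<integral>\<^sup>+\<omega>. ?b \<partial>law t) = ?b"
    using prob_space.emeasure_space_1[OF prob_space_law[of t]] by simp
  finally have step: "(\<integral>\<^sup>+\<omega>. pick t \<omega> i * of_bool (l \<le> pulls \<omega> i t) \<partial>law t) \<le> ?A + ?H + ?b" .
  have "?L (Suc t) = ?L t + (\<integral>\<^sup>+\<omega>. pick t \<omega> i * of_bool (l \<le> pulls \<omega> i t) \<partial>law t)"
    by (rule nn_integral_cost_Suc) (use i in simp_all)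
  also have "\<dots> \<le> ((\<integral>\<^sup>+\<omega>. cost i ?a t \<omega> \<partial>law t) + (\<integral>\<^sup>+\<omega>. cost 1 ?h t \<omega> \<partial>law t)
      + ennreal (real t * exp (- real l * d\<^sup>2 / 2))) + (?A + ?H + ?b)"
    by (intro add_mono Suc.IH step)
  also have "\<dots> = ((\<integral>\<^sup>+\<omega>. cost i ?a t \<omega> \<partial>law t) + ?A) + ((\<integral>\<^sup>+\<omega>. cost 1 ?h t \<omega> \<partial>law t) + ?H)
      + (ennreal (real t * exp (- real l * d\<^sup>2 / 2)) + ?b)"
    by (simp only: add_ac)
  also have "(\<integral>\<^sup>+\<omega>. cost i ?a t \<omega> \<partial>law t) + ?A = (\<integral>\<^sup>+\<omega>. cost i ?a (Suc t) \<omega> \<partial>law (Suc t))"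
    by (rule nn_integral_cost_Suc[OF a i(1), symmetric])
  also have "(\<integral>\<^sup>+\<omega>. cost 1 ?h t \<omega> \<partial>law t) + ?H = (\<integral>\<^sup>+\<omega>. cost 1 ?h (Suc t) \<omega> \<partial>law (Suc t))"
    by (rule nn_integral_cost_Suc[OF h K1, symmetric])
  also have "ennreal (real t * exp (- real l * d\<^sup>2 / 2)) + ?b = ennreal (real (Suc t) * exp (- real l * d\<^sup>2 / 2))"
    by (simp add: distrib_right flip: ennreal_plus)
  finally show ?case .
qed

lemma expected_pulls_le:
  assumes i: "i \<in> {1..K}" "i \<noteq> 1" and d: "d > 0" "3 * d \<le> \<mu> 1 - \<mu> i" and l: "l > 0"
  shows "expected_pulls i T \<le> ennreal (real l + 7 + 49 / (2 * d\<^sup>2) + real T * exp (- real l * d\<^sup>2 / 2))"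
proof -
  have K1: "1 \<in> {1..K}" using K_ge_2 by auto
  have "expected_pulls i T \<le> (\<integral>\<^sup>+\<omega>. of_nat l + cost i (\<lambda>n _. of_bool (l \<le> n)) T \<omega> \<partial>law T)"
    unfolding expected_pulls_def by (intro nn_integral_mono pulls_le_cost_late)
  also have "\<dots> = of_nat l + (\<integral>\<^sup>+\<omega>. cost i (\<lambda>n _. of_bool (l \<le> n)) T \<omega> \<partial>law T)"
    using i prob_space.emeasure_space_1[OF prob_space_law[of T]]
    by (subst nn_integral_add) (auto intro: measurable_cost_law)
  also have "\<dots> \<le> of_nat l + (ennreal (1 + 1 / (2 * d\<^sup>2)) + ennreal (6 * (1 + 1 / (d\<^sup>2 / 4)))
      + ennreal (real T * exp (- real l * d\<^sup>2 / 2)))"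
    using d by (intro add_left_mono order_trans[OF late_pulls_le[OF i d l]] add_mono overestimation_le
        underestimation_le i K1 order_refl) auto
  also have "\<dots> = ennreal (real l + ((1 + 1 / (2 * d\<^sup>2)) + 6 * (1 + 1 / (d\<^sup>2 / 4)) + real T * exp (- real l * d\<^sup>2 / 2)))"
  proof -
    have "ennreal a + (ennreal b + ennreal c + ennreal e) = ennreal (a + (b + c + e))"
      if "a \<ge> 0" "b \<ge> 0" "c \<ge> 0" "e \<ge> 0" for a b c e
      using that by simp
    then show ?thesis
      unfolding ennreal_of_nat_eq_real_of_nat by this auto
  qed
  \<comment> \<open>\<open>7 = 1 + 6\<close> and \<open>49 / 2 = 1 / 2 + 6 * 4\<close>.\<close>
  also have "real l + ((1 + 1 / (2 * d\<^sup>2)) + 6 * (1 + 1 / (d\<^sup>2 / 4)) + real T * exp (- real l * d\<^sup>2 / 2))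
      = real l + 7 + 49 / (2 * d\<^sup>2) + real T * exp (- real l * d\<^sup>2 / 2)"
    using d by (simp add: field_simps)
  finally show ?thesis .
qed

lemma expected_pulls_Suc:
  assumes "i \<in> {1..K}"
  shows "expected_pulls i (Suc t) = expected_pulls i t + (\<integral>\<^sup>+\<omega>. pick t \<omega> i \<partial>law t)"
  using nn_integral_cost_Suc[of "\<lambda>_ _. 1" i t] assms
  by (simp add: expected_pulls_def pulls_eq_cost del: ts_run.simps)

lemma expected_pulls_0: "expected_pulls i 0 = 0"
  by (simp add: expected_pulls_def pulls_def del: ts_run.simps)

lemma sum_nn_integral_pick:
  "(\<Sum>i\<in>{1..K}. c i * (\<integral>\<^sup>+\<omega>. pick t \<omega> i \<partial>law t)) = (\<integral>\<^sup>+\<omega>. (\<Sum>i\<in>{1..K}. pick t \<omega> i * c i) \<partial>law t)"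
proof -
  have [measurable]: "(\<lambda>\<omega>. pick t \<omega> j) \<in> borel_measurable (law t)" for j
    unfolding borel_measurable_law by measurable
  show ?thesis
    by (subst nn_integral_sum) (auto simp: nn_integral_multc mult.commute[of "c _"])
qed

lemma sum_expected_pulls: "(\<Sum>i\<in>{1..K}. expected_pulls i T) = of_nat T"
proof (induction T)
  case (Suc t)
  have "(\<Sum>i\<in>{1..K}. 1 * (\<integral>\<^sup>+\<omega>. pick t \<omega> i \<partial>law t)) = (\<integral>\<^sup>+\<omega>. (\<Sum>i\<in>{1..K}. pick t \<omega> i * 1) \<partial>law t)"
    by (rule sum_nn_integral_pick)
  also have "\<dots> = (\<integral>\<^sup>+\<omega>. 1 \<partial>law t)"
    by (intro nn_integral_cong_AE eventually_mono[OF AE_sum_pick_eq_1]) simp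
  also have "\<dots> = 1"
    using prob_space.emeasure_space_1[OF prob_space_law[of t]] by simp
  finally show ?case
    using Suc by (simp add: expected_pulls_Suc sum.distrib add.commute)
qed (simp add: expected_pulls_0)

section \<open>Expected total reward in terms of expected pulls\<close>

lemma \<mu>_bounds:
  assumes "i \<in> {1..K}"
  shows "0 \<le> \<mu> i" "\<mu> i \<le> 1"
proof -
  interpret interval_bounded_random_variable "p i" "\<lambda>x. x" 0 1 by (rule interval_p[OF assms])
  show "0 \<le> \<mu> i"
    unfolding mean_def using AE_in_interval by (intro integral_nonneg_AE) (auto elim!: eventually_mono)
  have "\<mu> i \<le> (\<integral>x. 1 \<partial>p i)"
    unfolding mean_def using AE_in_interval
    by (intro integral_mono_AE) (auto elim!: eventually_mono intro: integrable)
  then show "\<mu> i \<le> 1" by (simp add: prob_space)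
qed

lemma nn_integral_reward:
  assumes i: "i \<in> {1..K}"
  shows "(\<integral>\<^sup>+x. ennreal (x i) \<partial>D) = ennreal (\<mu> i)"
proof -
  interpret interval_bounded_random_variable "p i" "\<lambda>x. x" 0 1 by (rule interval_p[OF i])
  have "(\<integral>\<^sup>+x. ennreal (x i) \<partial>D) = (\<integral>\<^sup>+x. ennreal x \<partial>p i)"
    by (rule nn_integral_p[OF i]) simp
  also have "\<dots> = ennreal (\<mu> i)"
    unfolding mean_def using AE_in_interval
    by (intro nn_integral_eq_integral) (auto elim!: eventually_mono intro: integrable)
  finally show ?thesis .
qed

lemma AE_D_nonneg:
  assumes i: "i \<in> {1..K}"
  shows "AE x in D. 0 \<le> x i"
proof -
  have "(\<lambda>x. x i) \<in> measurable D borel"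
    unfolding measurable_cong_sets[OF sets_D refl] using i by (rule measurable_component_singleton)
  moreover have "AE x in distr D borel (\<lambda>x. x i). 0 \<le> x"
    unfolding distr_D[OF i] using AE_p[OF i] by (auto elim!: eventually_mono)
  ultimately show ?thesis
    by (simp add: AE_distr_iff)
qed

lemma measurable_pulled_reward:
  assumes "q \<in> {1..t}"
  shows "(\<lambda>\<omega>. reward \<omega> (arm \<omega> q) q) \<in> borel_measurable (run_space K t)"
proof (rule measurable_compose_countable[where f = "\<lambda>i \<omega>. reward \<omega> i q"])
  show "(\<lambda>\<omega>. arm \<omega> q) \<in> measurable (run_space K t) (count_space UNIV)"
    using assms by (rule measurable_arm)
  fix i
  show "(\<lambda>\<omega>. reward \<omega> i q) \<in> borel_measurable (run_space K t)"
  proof (cases "i \<in> {1..K}")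
    case True
    then show ?thesis using assms by (intro measurable_reward)
  next
    \<comment> \<open>The space of runs allows arms outside \<open>{1..K}\<close>; there an
      extensional reward vector takes the constant value \<open>undefined\<close>, so measurability
      survives.\<close>
    case False
    have "reward \<omega> i q = undefined" if "\<omega> \<in> space (run_space K t)" for \<omega>
    proof -
      have "\<omega> q \<in> space (count_space UNIV \<Otimes>\<^sub>M (\<Pi>\<^sub>M i\<in>{1..K}. borel))"
        using that assms unfolding run_space_def space_PiM by (rule PiE_mem)
      then have "snd (\<omega> q) \<in> extensional {1..K}"
        by (auto simp: space_pair_measure space_PiM PiE_iff)
      then show ?thesis
        using False unfolding reward_def by (rule extensional_arb)
    qed
    then show ?thesis
      by (subst measurable_cong[where g = "\<lambda>_. undefined"]) auto
  qed
qed

lemma AE_reward_nonneg: "AE \<omega> in law t. \<forall>q\<in>{1..t}. 0 \<le> reward \<omega> (arm \<omega> q) q"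
proof (induction t)
  case (Suc t)
  have [measurable]: "(\<lambda>\<omega>. reward \<omega> (arm \<omega> q) q) \<in> borel_measurable (run_space K (Suc t))"
    if "q \<in> {1..Suc t}" for q
    using that by (rule measurable_pulled_reward)
  show ?case
  proof (rule AE_law_Suc, measurable, rule eventually_mono[OF Suc], intro ballI impI)
    fix \<omega> i
    assume w: "\<forall>q\<in>{1..t}. 0 \<le> reward \<omega> (arm \<omega> q) q" and i: "i \<in> {1..K}"
    show "AE x in D. \<forall>q\<in>{1..Suc t}. 0 \<le> reward (fun_upd \<omega> (Suc t) (i, x)) (arm (fun_upd \<omega> (Suc t) (i, x)) q) q"
    proof (rule eventually_mono[OF AE_D_nonneg[OF i]], intro ballI)
      fix x :: "nat \<Rightarrow> real" and q assume "0 \<le> x i" "q \<in> {1..Suc t}"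
      then show "0 \<le> reward (fun_upd \<omega> (Suc t) (i, x)) (arm (fun_upd \<omega> (Suc t) (i, x)) q) q"
        using w by (cases "q = Suc t") (auto simp: reward_def arm_def)
    qed
  qed
qed simp

text \<open>A Wald-type identity: the reward of a round is independent of the arm chosen in it, so
  each pull of \<open>i\<close> contributes \<open>\<mu> i\<close> on average. Truncation by
  \<open>ennreal\<close> changes nothing almost surely, by \<open>AE_reward_nonneg\<close>.\<close>

lemma nn_integral_total_reward:
  "(\<integral>\<^sup>+\<omega>. (\<Sum>q\<in>{1..T}. ennreal (reward \<omega> (arm \<omega> q) q)) \<partial>law T) =
    (\<Sum>i\<in>{1..K}. ennreal (\<mu> i) * expected_pulls i T)"
proof (induction T)
  case (Suc t)
  have meas: "(\<lambda>\<omega>. \<Sum>q\<in>{1..s}. ennreal (reward \<omega> (arm \<omega> q) q)) \<in> borel_measurable (run_space K t')" if "s \<le> t'" for s t'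
    using that by (intro borel_measurable_sum measurable_compose[OF measurable_pulled_reward measurable_ennreal]) auto
  have meas'[measurable]: "(\<lambda>\<omega>. \<Sum>q\<in>{1..t}. ennreal (reward \<omega> (arm \<omega> q) q)) \<in> borel_measurable (law t)"
    "(\<lambda>\<omega>. pick t \<omega> i) \<in> borel_measurable (law t)" for i
    unfolding borel_measurable_law by (rule meas[OF order_refl]) measurable
  have upd: "(\<Sum>q\<in>{1..Suc t}. ennreal (reward (fun_upd \<omega> (Suc t) (i, x)) (arm (fun_upd \<omega> (Suc t) (i, x)) q) q))
    = (\<Sum>q\<in>{1..t}. ennreal (reward \<omega> (arm \<omega> q) q)) + ennreal (x i)" for \<omega> i x
  proof -
    have "(\<Sum>q\<in>{1..t}. ennreal (reward (fun_upd \<omega> (Suc t) (i, x)) (arm (fun_upd \<omega> (Suc t) (i, x)) q) q))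
      = (\<Sum>q\<in>{1..t}. ennreal (reward \<omega> (arm \<omega> q) q))"
      by (intro sum.cong) (auto simp: reward_def arm_def)
    then show ?thesis by (simp add: reward_def arm_def)
  qed
  have "(\<integral>\<^sup>+\<omega>. (\<Sum>q\<in>{1..Suc t}. ennreal (reward \<omega> (arm \<omega> q) q)) \<partial>law (Suc t)) =
    (\<integral>\<^sup>+\<omega>. (\<Sum>i\<in>{1..K}. pick t \<omega> i * (\<integral>\<^sup>+x. (\<Sum>q\<in>{1..t}. ennreal (reward \<omega> (arm \<omega> q) q)) + ennreal (x i) \<partial>D)) \<partial>law t)"
    unfolding nn_integral_law_Suc[OF meas[OF order_refl]] upd ..
  also have "\<dots> = (\<integral>\<^sup>+\<omega>. (\<Sum>i\<in>{1..K}. pick t \<omega> i) * (\<Sum>q\<in>{1..t}. ennreal (reward \<omega> (arm \<omega> q) q))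
      + (\<Sum>i\<in>{1..K}. pick t \<omega> i * ennreal (\<mu> i)) \<partial>law t)"
  proof (rule nn_integral_cong)
    fix \<omega>
    have "(\<integral>\<^sup>+x. (\<Sum>q\<in>{1..t}. ennreal (reward \<omega> (arm \<omega> q) q)) + ennreal (x i) \<partial>D)
      = (\<Sum>q\<in>{1..t}. ennreal (reward \<omega> (arm \<omega> q) q)) + ennreal (\<mu> i)" if i: "i \<in> {1..K}" for i
    proof -
      have [measurable]: "(\<lambda>x. x i) \<in> measurable D borel"
        unfolding measurable_cong_sets[OF sets_D refl] using i by (rule measurable_component_singleton)
      show ?thesis
        by (subst nn_integral_add) (auto simp: nn_integral_reward[OF i])
    qed
    then show "(\<Sum>i\<in>{1..K}. pick t \<omega> i * (\<integral>\<^sup>+x. (\<Sum>q\<in>{1..t}. ennreal (reward \<omega> (arm \<omega> q) q)) + ennreal (x i) \<partial>D))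
      = (\<Sum>i\<in>{1..K}. pick t \<omega> i) * (\<Sum>q\<in>{1..t}. ennreal (reward \<omega> (arm \<omega> q) q))
        + (\<Sum>i\<in>{1..K}. pick t \<omega> i * ennreal (\<mu> i))"
      by (simp only: distrib_left sum.distrib sum_distrib_right cong: sum.cong)
  qed
  also have "\<dots> = (\<integral>\<^sup>+\<omega>. (\<Sum>q\<in>{1..t}. ennreal (reward \<omega> (arm \<omega> q) q))
      + (\<Sum>i\<in>{1..K}. pick t \<omega> i * ennreal (\<mu> i)) \<partial>law t)"
    by (intro nn_integral_cong_AE eventually_mono[OF AE_sum_pick_eq_1]) (simp only: mult_1_left)
  also have "\<dots> = (\<integral>\<^sup>+\<omega>. (\<Sum>q\<in>{1..t}. ennreal (reward \<omega> (arm \<omega> q) q)) \<partial>law t)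
      + (\<integral>\<^sup>+\<omega>. (\<Sum>i\<in>{1..K}. pick t \<omega> i * ennreal (\<mu> i)) \<partial>law t)"
    by (rule nn_integral_add) measurable
  also have "\<dots> = (\<Sum>i\<in>{1..K}. ennreal (\<mu> i) * expected_pulls i (Suc t))"
    unfolding Suc sum_nn_integral_pick[symmetric]
    by (simp add: expected_pulls_Suc distrib_left sum.distrib)
  finally show ?case .
qed (simp add: expected_pulls_0)

end

section \<open>Regret\<close>

context thompson
begin

definition mean_pulls :: "nat \<Rightarrow> nat \<Rightarrow> real" where
  "mean_pulls i T = enn2real (expected_pulls i T)"

lemma mean_pulls_nonneg: "0 \<le> mean_pulls i T"
  by (simp add: mean_pulls_def)

lemma expected_pulls_eq: "expected_pulls i T = ennreal (mean_pulls i T)"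
proof -
  have "expected_pulls i T \<le> (\<integral>\<^sup>+\<omega>. of_nat T \<partial>law T)"
    unfolding expected_pulls_def by (intro nn_integral_mono) (simp add: pulls_le)
  also have "\<dots> = of_nat T"
    using prob_space.emeasure_space_1[OF prob_space_law[of T]] by simp
  also have "\<dots> < \<top>" by (rule of_nat_less_top)
  finally show ?thesis by (simp add: mean_pulls_def)
qed

lemma sum_mean_pulls: "(\<Sum>i\<in>{1..K}. mean_pulls i T) = real T"
proof -
  have "ennreal (\<Sum>i\<in>{1..K}. mean_pulls i T) = ennreal (real T)"
    using sum_expected_pulls[of T]
    by (simp add: expected_pulls_eq sum_ennreal mean_pulls_nonneg ennreal_of_nat_eq_real_of_nat)
  then show ?thesis
    by (subst (asm) ennreal_inj) (auto intro: sum_nonneg mean_pulls_nonneg)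
qed

lemma ts_regret_eq: "ts_regret K p D init brk T = (\<Sum>i\<in>{1..K}. gap p i * mean_pulls i T)"
proof -
  let ?R = "\<lambda>\<omega>. \<Sum>t\<in>{1..T}. reward \<omega> (arm \<omega> t) t"
  have "?R \<in> borel_measurable (law T)"
    unfolding borel_measurable_law by (intro borel_measurable_sum measurable_pulled_reward)
  moreover have "AE \<omega> in law T. 0 \<le> ?R \<omega>"
    by (rule eventually_mono[OF AE_reward_nonneg]) (auto intro: sum_nonneg)
  ultimately have "(\<integral>\<omega>. ?R \<omega> \<partial>law T) = enn2real (\<integral>\<^sup>+\<omega>. ennreal (?R \<omega>) \<partial>law T)"
    by (rule integral_eq_nn_integral)
  also have "(\<integral>\<^sup>+\<omega>. ennreal (?R \<omega>) \<partial>law T) = (\<integral>\<^sup>+\<omega>. (\<Sum>t\<in>{1..T}. ennreal (reward \<omega> (arm \<omega> t) t)) \<partial>law T)"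
    by (intro nn_integral_cong_AE eventually_mono[OF AE_reward_nonneg] sum_ennreal[symmetric]) auto
  also have "\<dots> = ennreal (\<Sum>i\<in>{1..K}. \<mu> i * mean_pulls i T)"
    unfolding nn_integral_total_reward expected_pulls_eq
    by (subst sum_ennreal[symmetric]) (auto simp: ennreal_mult \<mu>_bounds mean_pulls_nonneg)
  also have "enn2real \<dots> = (\<Sum>i\<in>{1..K}. \<mu> i * mean_pulls i T)"
    by (intro enn2real_ennreal sum_nonneg mult_nonneg_nonneg \<mu>_bounds mean_pulls_nonneg)
  finally show ?thesis
    unfolding ts_regret_def gap_def sum_mean_pulls[symmetric]
    by (simp add: right_diff_distrib sum_subtractf sum_distrib_left mult.commute)
qed

section \<open>The problem-dependent bound\<close>

lemma gap_bounds:
  assumes "i \<in> {1..K}"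
  shows "gap p i \<le> 1" "i \<noteq> 1 \<Longrightarrow> gap p i > 0"
proof -
  have K1: "1 \<in> {1..K}" using K_ge_2 by auto
  show "gap p i \<le> 1" using \<mu>_bounds[OF assms] \<mu>_bounds[OF K1] by (simp add: gap_def)
  show "i \<noteq> 1 \<Longrightarrow> gap p i > 0" using bandit assms by (simp add: bandit_def gap_def)
qed

text \<open>The shift in the logarithm keeps it at least 1, since \<open>100 powr (1/3)\<close>
  exceeds \<open>64 powr (1/3) = 4\<close>, which exceeds \<open>exp 1\<close>. Additive constants
  can then be absorbed into the logarithmic term.\<close>

lemma ln_ge_1:
  fixes x :: real
  assumes "x \<ge> 0"
  shows "1 \<le> ln (x + 100 powr (1 / 3))"
proof -
  have "exp 1 \<le> (3::real)" by (rule exp_le)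
  then have "exp 1 \<le> (64::real) powr (1 / 3)"
    using powr_powr[of 4 3 "1 / 3"] by simp
  also have "\<dots> \<le> x + 100 powr (1 / 3)"
    using assms powr_mono2[of "1 / 3" 64 100] by simp
  finally show ?thesis
    using ln_ge_iff[of "x + 100 powr (1 / 3)" 1] assms by (simp add: add_nonneg_pos)
qed

lemma gap_mean_pulls_le:
  assumes i: "i \<in> {1..K}" "i \<noteq> 1"
  shows "gap p i * mean_pulls i T \<le>
    1270 * ln (real T * (gap p i)\<^sup>2 + 100 powr (1/3)) / gap p i + 182.5 / gap p i + gap p i"
proof -
  define \<Delta> where "\<Delta> = gap p i"
  define A where "A = real T * \<Delta>\<^sup>2 + 100 powr (1/3)"
  \<comment> \<open>Solves \<open>L * d^2 / 2 = ln A\<close> for \<open>d = \<Delta> / 3\<close>.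
    Each round then contributes at most \<open>1 / A\<close>, and all \<open>T\<close> rounds
    together at most \<open>T / A \<le> 1 / \<Delta>^2\<close>.\<close>
  define L where "L = 18 * ln A / \<Delta>\<^sup>2"
  define l where "l = nat \<lceil>L\<rceil>"
  have \<Delta>: "0 < \<Delta>" "\<Delta> \<le> 1" using gap_bounds[of i] i by (auto simp: \<Delta>_def)
  have lnA: "1 \<le> ln A" unfolding A_def by (rule ln_ge_1) simp
  have "0 < (100::real) powr (1/3)" by simp
  then have A: "0 < A" "real T * \<Delta>\<^sup>2 \<le> A" unfolding A_def by (auto intro: add_nonneg_pos)
  have L: "0 < L" using \<Delta> lnA by (simp add: L_def)
  then have l: "l > 0" "L \<le> real l" "real l \<le> L + 1" unfolding l_def by linarith+
  have "expected_pulls i T \<le> ennreal (real l + 7 + 49 / (2 * (\<Delta> / 3)\<^sup>2) + real T * exp (- real l * (\<Delta> / 3)\<^sup>2 / 2))"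
    using \<Delta> l by (intro expected_pulls_le i) (auto simp: \<Delta>_def gap_def)
  then have "mean_pulls i T \<le> real l + 7 + 49 / (2 * (\<Delta> / 3)\<^sup>2) + real T * exp (- real l * (\<Delta> / 3)\<^sup>2 / 2)"
    unfolding expected_pulls_eq by (subst (asm) ennreal_le_iff) auto
  also have "real T * exp (- real l * (\<Delta> / 3)\<^sup>2 / 2) \<le> 1 / \<Delta>\<^sup>2"
  proof -
    have "ln A = L * (\<Delta> / 3)\<^sup>2 / 2" using \<Delta> by (simp add: L_def power_divide)
    also have "\<dots> \<le> real l * (\<Delta> / 3)\<^sup>2 / 2" using l by (intro divide_right_mono mult_right_mono) auto
    finally have "exp (- real l * (\<Delta> / 3)\<^sup>2 / 2) \<le> exp (- ln A)" by simp
    then have "real T * exp (- real l * (\<Delta> / 3)\<^sup>2 / 2) \<le> real T * (1 / A)"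
      using A by (intro mult_left_mono) (auto simp: exp_minus inverse_eq_divide)
    also have "\<dots> \<le> 1 / \<Delta>\<^sup>2" using A \<Delta> by (simp add: field_simps)
    finally show ?thesis .
  qed
  also have "49 / (2 * (\<Delta> / 3)\<^sup>2) = 220.5 / \<Delta>\<^sup>2" using \<Delta> by (simp add: field_simps power2_eq_square)
  also have "real l \<le> 18 * ln A / \<Delta>\<^sup>2 + 1" using l by (simp add: L_def)
  finally have "\<Delta> * mean_pulls i T \<le> \<Delta> * (18 * ln A / \<Delta>\<^sup>2 + 1 + 7 + 220.5 / \<Delta>\<^sup>2 + 1 / \<Delta>\<^sup>2)"
    using \<Delta> by (intro mult_left_mono) auto
  also have "\<dots> = 18 * ln A / \<Delta> + 7 * \<Delta> + 221.5 / \<Delta> + \<Delta>"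
    using \<Delta> by (simp add: field_simps power2_eq_square)
  also have "7 * \<Delta> \<le> 7 / \<Delta>"
  proof -
    have "\<Delta> * \<Delta> \<le> 1" using \<Delta> by (intro mult_le_one) auto
    then show ?thesis using \<Delta> by (simp add: field_simps)
  qed
  also have "18 * ln A / \<Delta> + 7 / \<Delta> + 221.5 / \<Delta> + \<Delta> = (18 * ln A + 228.5) / \<Delta> + \<Delta>"
    by (simp add: add_divide_distrib)
  \<comment> \<open>The additive constant exceeds the required 182.5 by 46, which the surplus
    \<open>1252 * ln A\<close> of the logarithmic term covers.\<close>
  also have "\<dots> \<le> (1270 * ln A + 182.5) / \<Delta> + \<Delta>"
    using \<Delta> lnA by (intro add_right_mono divide_right_mono) auto
  finally show ?thesis by (simp add: \<Delta>_def A_def add_divide_distrib)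
qed

lemma ts_regret_le:
  "ts_regret K p D init brk T \<le> (\<Sum>i\<in>{i\<in>{1..K}. gap p i > 0}.
     1270 * ln (real T * (gap p i)\<^sup>2 + 100 powr (1/3)) / gap p i + 182.5 / gap p i + gap p i)"
proof -
  have "gap p 1 = 0" by (simp add: gap_def)
  then have "ts_regret K p D init brk T = (\<Sum>i\<in>{i\<in>{1..K}. gap p i > 0}. gap p i * mean_pulls i T)"
    unfolding ts_regret_eq using gap_bounds(2) by (intro sum.mono_neutral_right) force+
  also have "\<dots> \<le> (\<Sum>i\<in>{i\<in>{1..K}. gap p i > 0}.
     1270 * ln (real T * (gap p i)\<^sup>2 + 100 powr (1/3)) / gap p i + 182.5 / gap p i + gap p i)"
  proof (rule sum_mono)
    fix i assume "i \<in> {i \<in> {1..K}. gap p i > 0}"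
    then show "gap p i * mean_pulls i T \<le>
      1270 * ln (real T * (gap p i)\<^sup>2 + 100 powr (1/3)) / gap p i + 182.5 / gap p i + gap p i"
      using \<open>gap p 1 = 0\<close> by (intro gap_mean_pulls_le) auto
  qed
  finally show ?thesis .
qed

section \<open>The worst-case bound\<close>

lemma ln_K_ge: "1 / 2 \<le> ln (real K)"
proof -
  have "ln 2 \<le> ln (real K)" using K_ge_2 by simp
  then show ?thesis using ln2_ge_two_thirds by simp
qed

text \<open>At the critical gap \<open>e\<close> one has \<open>T * e^2 = K * ln K\<close>, so this
  is the logarithm of the problem-dependent bound there; it is of order \<open>ln K\<close> with no
  dependence on \<open>T\<close>. The reason is
  \<open>K * ln K + 5 \<le> 4 * K^2 \<le> K^4\<close>.\<close>

lemma ln_K_le: "ln (real K * ln (real K) + 100 powr (1 / 3)) \<le> 4 * ln (real K)"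
proof -
  have "(100::real) powr (1 / 3) \<le> 125 powr (1 / 3)" by (rule powr_mono2) auto
  also have "\<dots> = 5" using powr_powr[of 5 3 "1 / 3"] by simp
  finally have c: "(100::real) powr (1 / 3) \<le> 5" .
  have K: "2 \<le> real K" using K_ge_2 by simp
  have "real K * ln (real K) \<le> (real K)\<^sup>2"
    using ln_le_minus_one[of "real K"] K unfolding power2_eq_square by (intro mult_left_mono) auto
  moreover have "4 \<le> (real K)\<^sup>2" using power_mono[of 2 "real K" 2] K by simp
  then have "4 * (real K)\<^sup>2 \<le> (real K)\<^sup>2 * (real K)\<^sup>2" by (intro mult_right_mono) auto
  moreover have "(real K)\<^sup>2 * (real K)\<^sup>2 = real K ^ 4" by (simp flip: power_add)
  ultimately have "real K * ln (real K) + 100 powr (1 / 3) \<le> real K ^ 4"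
    using c \<open>4 \<le> (real K)\<^sup>2\<close> by linarith
  moreover have "0 < real K * ln (real K) + 100 powr (1 / 3)"
    using K by (intro add_nonneg_pos) auto
  ultimately have "ln (real K * ln (real K) + 100 powr (1 / 3)) \<le> ln (real K ^ 4)"
    by (intro ln_mono) auto
  then show ?thesis using K by (simp add: ln_realpow)
qed

text \<open>Above the critical gap, write the gap as \<open>e * r\<close> with
  \<open>r \<ge> 1\<close>. The logarithm grows by at most \<open>2 * ln r \<le> 2 * r\<close>, and
  division by the gap cancels the factor \<open>r\<close>, so up to constants the critical gap is
  the worst one.\<close>

lemma gap_mean_pulls_le_uniform:
  assumes i: "i \<in> {1..K}" and e: "e > 0" "real T * e\<^sup>2 = real K * ln (real K)"
  shows "gap p i * mean_pulls i T \<le> e * mean_pulls i T + (10525 * ln (real K) / e + 1)"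
proof -
  let ?c = "(100::real) powr (1 / 3)"
  have c: "0 < ?c" by simp
  have r0: "0 \<le> 10525 * ln (real K) / e + 1" using ln_K_ge e by simp
  show ?thesis
  proof (cases "gap p i \<le> e")
    case True
    then have "gap p i * mean_pulls i T \<le> e * mean_pulls i T"
      by (intro mult_right_mono mean_pulls_nonneg)
    with r0 show ?thesis by linarith
  next
    case False
    then have g: "e < gap p i" by simp
    then have "i \<noteq> 1" using e by (auto simp: gap_def)
    define r where "r = gap p i / e"
    have r: "1 \<le> r" "gap p i = e * r" using g e by (auto simp: r_def)
    have "real T * (gap p i)\<^sup>2 + ?c \<le> r\<^sup>2 * (real K * ln (real K) + ?c)"
    proof -
      have "1 \<le> r\<^sup>2" using r by simp
      then have "1 * ?c \<le> r\<^sup>2 * ?c" using c by (intro mult_right_mono) auto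
      then show ?thesis by (simp add: r(2) power_mult_distrib distrib_left flip: e(2))
    qed
    moreover have "0 < real T * (gap p i)\<^sup>2 + ?c" using c by (intro add_nonneg_pos) auto
    ultimately have "ln (real T * (gap p i)\<^sup>2 + ?c) \<le> ln (r\<^sup>2 * (real K * ln (real K) + ?c))"
      by (intro ln_mono) auto
    also have "\<dots> = ln (r\<^sup>2) + ln (real K * ln (real K) + ?c)"
      using r K_ge_2 c by (intro ln_mult_pos) (auto intro!: add_nonneg_pos)
    also have "\<dots> \<le> 2 * r + 4 * ln (real K)"
      using ln_K_le ln_le_minus_one[of r] r by (simp add: ln_realpow)
    also have "\<dots> \<le> r * (2 + 4 * ln (real K))"
    proof -
      have "1 * (4 * ln (real K)) \<le> r * (4 * ln (real K))"
        using r ln_K_ge by (intro mult_right_mono) auto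
      then show ?thesis by (simp add: distrib_left)
    qed
    finally have "1270 * ln (real T * (gap p i)\<^sup>2 + ?c) / gap p i \<le> 1270 * (r * (2 + 4 * ln (real K))) / gap p i"
      using g e by (intro divide_right_mono) auto
    also have "\<dots> = 1270 * (2 + 4 * ln (real K)) / e" using r e by simp
    \<comment> \<open>Uses \<open>2 \<le> 4 * ln K\<close>. The final coefficient is
      \<open>10525 = 1270 * 8 + 182.5 * 2\<close>, where the second doubling again comes from
      \<open>ln K \<ge> 1 / 2\<close>.\<close>
    also have "\<dots> \<le> 1270 * (8 * ln (real K)) / e"
      using ln_K_ge e by (intro divide_right_mono mult_left_mono) auto
    finally have a: "1270 * ln (real T * (gap p i)\<^sup>2 + ?c) / gap p i \<le> 10160 * ln (real K) / e" by simp
    have "182.5 / gap p i \<le> 182.5 / e"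
      using g e by (intro divide_left_mono) auto
    also have "\<dots> \<le> 365 * ln (real K) / e"
      using ln_K_ge e by (intro divide_right_mono) auto
    finally have b: "182.5 / gap p i \<le> 365 * ln (real K) / e" .
    have "gap p i * mean_pulls i T \<le> 10160 * ln (real K) / e + 365 * ln (real K) / e + 1"
      using gap_mean_pulls_le[OF i \<open>i \<noteq> 1\<close>, of T] a b gap_bounds(1)[OF i] by linarith
    also have "\<dots> = 10525 * ln (real K) / e + 1" by (simp add: add_divide_distrib[symmetric])
    also have "\<dots> \<le> e * mean_pulls i T + (10525 * ln (real K) / e + 1)"
      using e mean_pulls_nonneg by simp
    finally show ?thesis .
  qed
qed

text \<open>The summand 1 per arm adds up to \<open>K\<close>, which is of the right order only for
  \<open>K \<le> T\<close>. For \<open>T < K\<close> the trivial bound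
  \<open>T \<le> sqrt (K * T)\<close> suffices, and this case also keeps \<open>T = 0\<close> out of
  the division by \<open>T\<close>.\<close>

lemma ts_regret_worst_case: "ts_regret K p D init brk T \<le> 10528 * sqrt (real K * real T * ln (real K))"
proof -
  define X where "X = sqrt (real K * real T * ln (real K))"
  have X0: "0 \<le> X" using K_ge_2 by (simp add: X_def)
  have ln0: "0 < ln (real K)" using ln_K_ge by simp
  have sqrt_le: "sqrt (real K * real T) \<le> 2 * X"
  proof -
    have "real K * real T * 1 \<le> real K * real T * (4 * ln (real K))"
      using ln_K_ge by (intro mult_left_mono) auto
    then have "sqrt (real K * real T) \<le> sqrt (4 * (real K * real T * ln (real K)))"
      by (intro real_sqrt_le_mono) simp
    then show ?thesis unfolding X_def real_sqrt_mult[of 4] by simp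
  qed
  show ?thesis
  proof (cases "T < K")
    case True
    have "ts_regret K p D init brk T \<le> (\<Sum>i\<in>{1..K}. 1 * mean_pulls i T)"
      unfolding ts_regret_eq by (intro sum_mono mult_right_mono gap_bounds mean_pulls_nonneg)
    also have "\<dots> = sqrt (real T * real T)"
      by (simp only: mult_1_left sum_mean_pulls) simp
    also have "\<dots> \<le> sqrt (real K * real T)"
      using True by (intro real_sqrt_le_mono mult_right_mono) auto
    also have "\<dots> \<le> 10528 * X" using sqrt_le X0 by linarith
    finally show ?thesis by (simp add: X_def)
  next
    case False
    then have T: "real T > 0" and K: "real K > 0" using K_ge_2 by auto
    \<comment> \<open>This is \<open>sqrt (K * ln K / T)\<close>, the value that balances the two
      contributions: both \<open>e * T\<close> and \<open>K * ln K / e\<close> equal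
      \<open>X\<close>.\<close>
    define e where "e = X / real T"
    have X: "X > 0" using T K ln0 by (simp add: X_def)
    have XX: "X * X = real K * real T * ln (real K)"
      unfolding X_def using ln0 by simp
    have e: "e > 0" "real T * e\<^sup>2 = real K * ln (real K)"
      using X T XX by (auto simp: e_def power2_eq_square)
    have eT: "e * real T = X" using T by (simp add: e_def)
    have "real K * ln (real K) / e = X"
    proof -
      have "real K * ln (real K) / e = X * X / (e * real T)"
        using T e(1) by (simp add: XX)
      then show ?thesis using X by (simp add: eT)
    qed
    then have Ke: "real K * (10525 * ln (real K) / e) = 10525 * X"
      by (metis mult.left_commute times_divide_eq_right)
    have "real K \<le> sqrt (real K * real K)" by simp
    also have "\<dots> \<le> sqrt (real K * real T)"
      using False by (intro real_sqrt_le_mono mult_left_mono) auto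
    also note sqrt_le
    finally have K2: "real K \<le> 2 * X" .
    have "ts_regret K p D init brk T \<le> (\<Sum>i\<in>{1..K}. e * mean_pulls i T + (10525 * ln (real K) / e + 1))"
      unfolding ts_regret_eq by (intro sum_mono gap_mean_pulls_le_uniform e)
    also have "\<dots> = e * (\<Sum>i\<in>{1..K}. mean_pulls i T) + real K * (10525 * ln (real K) / e + 1)"
      by (simp add: sum.distrib sum_distrib_left)
    also have "\<dots> = e * real T + real K * (10525 * ln (real K) / e + 1)"
      by (simp only: sum_mean_pulls)
    also have "\<dots> = X + 10525 * X + real K"
      unfolding distrib_left Ke eT by simp
    \<comment> \<open>\<open>10528 = 1 + 10525 + 2\<close>: the small gaps, the large gaps, and the
      leftover \<open>K \<le> 2 * X\<close>.\<close>
    also have "\<dots> \<le> 10528 * X" using K2 by linarith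
    finally show ?thesis by (simp add: X_def)
  qed
qed

end

theorem theorem1:
  shows "(\<forall>K p D init brk (T::nat).
            bandit K p D \<and> ts_params K init brk \<longrightarrow>
            ts_regret K p D init brk T \<le>
              (\<Sum>i\<in>{i\<in>{1..K}. gap p i > 0}.
                 1270 * ln (real T * (gap p i)\<^sup>2 + 100 powr (1/3)) / gap p i
                 + 182.5 / gap p i + gap p i))
       \<and> (\<exists>C>0. \<forall>K p D init brk (T::nat).
            bandit K p D \<and> ts_params K init brk \<longrightarrow>
            ts_regret K p D init brk T \<le> C * sqrt (real K * real T * ln (real K)))"
proof (intro conjI exI[of _ 10528] allI impI)
  show "0 < (10528 :: real)" by simp
qed (use thompson.ts_regret_le thompson.ts_regret_worst_case in \<open>auto simp: thompson_def\<close>)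

end
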